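(* Let $n\ge 1$, let $g$ be an $n$-dimensional standard Gaussian vector, and let $F:\mathbb{R}^n\to\mathbb{R}$ be a convex function with $\mathbb{E}F(g)^2<\infty$. Define $\Phi(\lambda)=\frac{1}{\lambda}\ln\mathbb{E}\,e^{\lambda F(g)}$ for $\lambda<0$ and $\Phi(0)=\mathbb{E}F(g)$. Then: 1. For any $\lambda\le 0$, $$\ln\mathbb{E}\,e^{\lambda(F(g)-\mathbb{E}F(g))}\le\frac{\lambda^2}{2}\mathrm{Var}(F(g)).$$ 2. For any $\lambda\le 0$, $$\bigl|\Phi(\lambda)-\mathbb{E}F(g)\bigr|\le\frac{|\lambda|}{2}\mathrm{Var}(F(g)).$$ 3. For any $\lambda,\lambda'<0$, $$|\Phi'(\lambda)-\Phi'(\lambda')|\le\Bigl|\ln\frac{\lambda}{\lambda'}\Bigr|\,\mathrm{Var}(F(g)).$$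
   Context: A standard Gaussian vector in $\mathbb{R}^n$ has i.i.d. $N(0,1)$ coordinates. For $\lambda<0$, $\mathbb{E}\,e^{\lambda F(g)}$ is finite because a convex function is bounded below by an affine function. $\Phi'$ denotes the derivative of $\Phi$ on $(-\infty,0)$. *)

theory Defs
  imports "HOL-Probability.Probability"
begin

definition standard_gaussian_vector :: "'w measure \<Rightarrow> ('w \<Rightarrow> real ^ 'n) \<Rightarrow> bool" where
  "standard_gaussian_vector M g \<longleftrightarrow>
     prob_space.indep_vars M (\<lambda>_. borel) (\<lambda>i \<omega>. g \<omega> $ i) UNIV \<and>
     (\<forall>i. distributed M lborel (\<lambda>\<omega>. g \<omega> $ i) std_normal_density)"

(* Only arguments l \<le> 0 are meaningful: for l > 0 the exponential moment may be infinite. *)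
definition Phi :: "'w measure \<Rightarrow> ('w \<Rightarrow> real) \<Rightarrow> real \<Rightarrow> real" where
  "Phi M X l = (if l = 0 then prob_space.expectation M X
                else (1 / l) * ln (prob_space.expectation M (\<lambda>\<omega>. exp (l * X \<omega>))))"

end

theory Submission
  imports Defs "HOL-Real_Asymp.Real_Asymp"
begin

text \<open>For \<open>m > 0\<close> put \<open>\<Psi> m = - ln (E (exp (- m F))) / m\<close>, that is \<open>\<Psi> m = \<Phi> (- m)\<close>. The key point is
  that \<open>\<Psi>\<close> is convex. More generally, if \<open>F m x\<close> is jointly convex in \<open>m > 0\<close> and the point \<open>x\<close>, then
  integrating \<open>exp (- m F m)\<close> over one Gaussian coordinate and taking \<open>- ln (\<dots>) / m\<close> gives a jointly
  convex function of \<open>m\<close> and the remaining coordinates, so convexity follows by induction on the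
  coordinates. The one-dimensional step is a transport proof in the style of Prekopa and Leindler:
  for the increasing maps \<open>T\<^sub>i\<close> that push the Gaussian measure to the normalisation of
  \<open>exp (- m\<^sub>i F\<^sub>i)\<close> times it, one has \<open>T\<^sub>i' \<le> 1\<close>, and on \<open>{-1<..0}\<close> the function
  \<open>r - ln (1 + r)\<close> has a convex square root, which makes \<open>(r - ln (1 + r)) / m\<close> jointly convex.

  Convexity of \<open>\<Psi>\<close> bounds its difference quotients by their limit at \<open>0\<close>, which is half the
  variance; this gives the first two claims. The third follows because \<open>\<Psi>'\<close> is increasing,
  \<open>- \<Psi>'\<close> is at most half the variance, and the relative entropy \<open>- m\<^sup>2 \<Psi>' m\<close> increases
  with \<open>m\<close>.\<close>

section \<open>Joint convexity of the one-dimensional cost\<close>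

text \<open>Divided by \<open>m\<close>, this is joint convexity of \<open>q^2 / m\<close>: the
  defect is an explicit nonnegative multiple of a square.\<close>

lemma perspective_square:
  fixes m0 m1 s q0 q1 :: real
  assumes "m0 > 0" "m1 > 0" "0 \<le> s" "s \<le> 1"
  defines "m \<equiv> (1 - s) * m0 + s * m1"
  shows "((1 - s) * q0 + s * q1)\<^sup>2 \<le> (1 - s) * m / m0 * q0\<^sup>2 + s * m / m1 * q1\<^sup>2"
proof -
  have "(1 - s) * m / m0 * q0\<^sup>2 + s * m / m1 * q1\<^sup>2 - ((1 - s) * q0 + s * q1)\<^sup>2
    = (1 - s) * s / (m0 * m1) * (m0 * q1 - m1 * q0)\<^sup>2"
    using assms(1,2) unfolding m_def by (simp add: field_simps power2_eq_square)
  also have "\<dots> \<ge> 0" using assms by simp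
  finally show ?thesis by simp
qed

text \<open>Both sides vanish at 0, and their difference has a derivative of constant sign. The
  constant 2 is what the second derivative in the next lemma demands.\<close>

lemma ln_add_one_le_quadratic:
  fixes r :: real
  assumes "-1 < r" "r \<le> 0"
  shows "r\<^sup>2 \<le> 2 * (r - ln (1 + r))"
proof -
  let ?h = "\<lambda>r::real. 2 * (r - ln (1 + r)) - r\<^sup>2"
  have "?h r \<ge> ?h 0"
  proof (rule DERIV_nonpos_imp_nonincreasing[OF assms(2)])
    fix x :: real assume x: "r \<le> x" "x \<le> 0"
    then have "1 + x > 0" using assms by simp
    then have "(?h has_real_derivative 2 * (1 - 1 / (1 + x)) - 2 * x) (at x)"
      by (auto intro!: derivative_eq_intros)
    moreover have "2 * (1 - 1 / (1 + x)) - 2 * x = - 2 * x\<^sup>2 / (1 + x)"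
      using \<open>1 + x > 0\<close> by (simp add: field_simps power2_eq_square)
    moreover have "- 2 * x\<^sup>2 / (1 + x) \<le> 0" using \<open>1 + x > 0\<close> by (simp add: field_simps)
    ultimately show "\<exists>y. (?h has_real_derivative y) (at x) \<and> y \<le> 0" by metis
  qed
  then show ?thesis by simp
qed

text \<open>The second derivative of \<open>q\<close> has numerator \<open>2 * ?G r - r^2\<close>,
  nonnegative by the preceding lemma. The point 0 is left out because \<open>?G\<close> vanishes
  there and the chain rule for the root fails.\<close>

lemma convex_on_sqrt_diff_ln_open:
  "convex_on {-1<..<0} (\<lambda>r::real. sqrt (r - ln (1 + r)))"
proof -
  let ?G = "\<lambda>r::real. r - ln (1 + r)"
  define q where "q = (\<lambda>r::real. sqrt (?G r))"
  have G: "?G r > 0" "r\<^sup>2 \<le> 2 * ?G r" if "r \<in> {-1<..<0}" for r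
  proof -
    show le: "r\<^sup>2 \<le> 2 * ?G r" using that by (intro ln_add_one_le_quadratic) auto
    have "0 < r\<^sup>2" using that by auto
    also note le
    finally have "0 < 2 * ?G r" .
    then show "?G r > 0" by simp
  qed
  have q: "q r > 0" "(q r)\<^sup>2 = ?G r" if "r \<in> {-1<..<0}" for r
    using G(1)[OF that] by (auto simp: q_def)
  have d1: "(q has_real_derivative (1 - 1 / (1 + r)) / (2 * q r)) (at r)" if "r \<in> {-1<..<0}" for r
  proof -
    have "((\<lambda>r. r - ln (1 + r)) has_real_derivative 1 - 1 / (1 + r)) (at r)"
      using that by (auto intro!: derivative_eq_intros)
    from DERIV_chain2[of sqrt _ "\<lambda>r. r - ln (1 + r)", OF DERIV_real_sqrt[OF G(1)[OF that]] this]
    show ?thesis unfolding q_def by (rule DERIV_cong) (simp add: field_simps)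
  qed
  have d2: "((\<lambda>r. (1 - 1 / (1 + r)) / (2 * q r)) has_real_derivative
      (2 * ?G r - r\<^sup>2) / (4 * (q r) ^ 3 * (1 + r)\<^sup>2)) (at r)" if "r \<in> {-1<..<0}" for r
  proof -
    have *: "1 + r \<noteq> 0" "q r \<noteq> 0" using that q(1)[OF that] by auto
    have "((\<lambda>r. (1 - 1 / (1 + r)) / (2 * q r)) has_real_derivative
      (1 / (1 + r)\<^sup>2 * (2 * q r) - (1 - 1 / (1 + r)) * (2 * ((1 - 1 / (1 + r)) / (2 * q r)))) / ((2 * q r) * (2 * q r))) (at r)"
      using * by (auto intro!: derivative_eq_intros d1[OF that] simp: field_simps power2_eq_square)
    moreover have "(1 / (1 + r)\<^sup>2 * (2 * q r) - (1 - 1 / (1 + r)) * (2 * ((1 - 1 / (1 + r)) / (2 * q r)))) / ((2 * q r) * (2 * q r))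
      = (2 * (q r)\<^sup>2 - r\<^sup>2) / (4 * (q r) ^ 3 * (1 + r)\<^sup>2)"
    proof -
      have e: "1 - 1 / (1 + r) = r / (1 + r)" using * by (simp add: field_simps)
      show ?thesis unfolding e using * by (simp add: divide_simps) (simp add: algebra_simps power2_eq_square power3_eq_cube)
    qed
    ultimately show ?thesis using q(2)[OF that] by simp
  qed
  show ?thesis
    unfolding q_def[symmetric]
  proof (rule f''_ge0_imp_convex)
    show "convex {-1<..<(0::real)}" by simp
  qed (use d1 d2 q G in \<open>auto intro!: divide_nonneg_nonneg mult_nonneg_nonneg intro: less_imp_le\<close>)
qed

lemma convex_on_sqrt_diff_ln:
  fixes r0 r1 s :: real
  assumes r: "-1 < r0" "r0 \<le> 0" "-1 < r1" "r1 \<le> 0" and s: "0 \<le> s" "s \<le> 1"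
  defines "q \<equiv> \<lambda>r::real. sqrt (r - ln (1 + r))"
  shows "q ((1 - s) * r0 + s * r1) \<le> (1 - s) * q r0 + s * q r1"
proof -
  \<comment> \<open>\<open>p r e\<close> moves \<open>r\<close> towards -1/2: it lies in the open
    interval, is affine in \<open>r\<close> and tends to \<open>r\<close>, so convexity extends to
    the endpoint 0 by continuity.\<close>
  define p where "p = (\<lambda>r e::real. (1 - e) * r - e / 2)"
  have pin: "p r e \<in> {-1<..<0}" if "-1 < r" "r \<le> 0" "0 < e" "e < 1" for r e
  proof -
    have "(1 - e) * r \<le> 0" using that by (simp add: mult_nonneg_nonpos)
    moreover have "(1 - e) * (-1) < (1 - e) * r" using that by (intro mult_strict_left_mono) auto
    ultimately show ?thesis using that unfolding p_def by auto
  qed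
  have pl: "((\<lambda>e. q (p r e)) \<longlongrightarrow> q r) (at_right 0)" if "-1 < r" for r
    unfolding q_def p_def using that by (auto intro!: tendsto_eq_intros)
  have r': "-1 < (1 - s) * r0 + s * r1"
    using convex_bound_lt[of "- r0" 1 "- r1" "1 - s" s] r s by simp
  have "((\<lambda>e. (1 - s) * q (p r0 e) + s * q (p r1 e)) \<longlongrightarrow> (1 - s) * q r0 + s * q r1) (at_right 0)"
    using pl r by (intro tendsto_intros) auto
  moreover have "((\<lambda>e. q (p ((1 - s) * r0 + s * r1) e)) \<longlongrightarrow> q ((1 - s) * r0 + s * r1)) (at_right 0)"
    by (rule pl[OF r'])
  moreover have "\<forall>\<^sub>F e in at_right 0. q (p ((1 - s) * r0 + s * r1) e) \<le> (1 - s) * q (p r0 e) + s * q (p r1 e)"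
  proof -
    have "\<forall>\<^sub>F e::real in at_right 0. e \<in> {0<..<1}" by (rule eventually_at_right_real) simp
    then show ?thesis
    proof eventually_elim
      case (elim e)
      have e: "p ((1 - s) * r0 + s * r1) e = (1 - s) * p r0 e + s * p r1 e"
        unfolding p_def by (simp add: field_simps)
      show ?case unfolding e q_def
        using convex_onD[OF convex_on_sqrt_diff_ln_open s, of "p r0 e" "p r1 e"] pin r elim by auto
    qed
  qed
  ultimately show ?thesis by (intro tendsto_le) auto
qed

text \<open>Convexity of the root \<open>q\<close> is followed by \<open>perspective_square\<close>
  for \<open>q r0\<close> and \<open>q r1\<close>. Convexity of \<open>r - ln (1 + r)\<close> itself
  would not suffice, as \<open>m / m0\<close> or \<open>m / m1\<close> can be below 1.\<close>

lemma perspective_diff_ln: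
  fixes m0 m1 s r0 r1 :: real
  assumes "m0 > 0" "m1 > 0" and s: "0 \<le> s" "s \<le> 1"
    and r: "-1 < r0" "r0 \<le> 0" "-1 < r1" "r1 \<le> 0"
  defines "m \<equiv> (1 - s) * m0 + s * m1" and "r \<equiv> (1 - s) * r0 + s * r1"
  shows "r - ln (1 + r) \<le> (1 - s) * m / m0 * (r0 - ln (1 + r0)) + s * m / m1 * (r1 - ln (1 + r1))"
proof -
  define q where "q \<equiv> \<lambda>r::real. sqrt (r - ln (1 + r))"
  have q: "(q t)\<^sup>2 = t - ln (1 + t)" "q t \<ge> 0" if "-1 < t" "t \<le> 0" for t
  proof -
    have "0 \<le> 2 * (t - ln (1 + t))" using ln_add_one_le_quadratic[OF that] by (rule order_trans[OF zero_le_power2])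
    then show "(q t)\<^sup>2 = t - ln (1 + t)" "q t \<ge> 0" unfolding q_def by auto
  qed
  have r': "-1 < r" "r \<le> 0"
    using convex_bound_lt[of "- r0" 1 "- r1" "1 - s" s] convex_bound_le[of r0 0 r1 "1 - s" s] r s
    by (simp_all add: r_def)
  have "(q r)\<^sup>2 \<le> ((1 - s) * q r0 + s * q r1)\<^sup>2"
    using convex_on_sqrt_diff_ln[OF r s] q(2)[OF r'] unfolding q_def r_def by (intro power_mono) auto
  also have "\<dots> \<le> (1 - s) * m / m0 * (q r0)\<^sup>2 + s * m / m1 * (q r1)\<^sup>2"
    unfolding m_def by (rule perspective_square) (use assms in auto)
  finally show ?thesis using q r r' by simp
qed

section \<open>Distribution functions and Gaussian integrability\<close>

lemma cdf_of_density:
  fixes h :: "real \<Rightarrow> real"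
  assumes cont: "continuous_on UNIV h" and int: "integrable lborel h"
  obtains H where "\<And>x. (H has_real_derivative h x) (at x)"
    "(H \<longlongrightarrow> 0) at_bot" "(H \<longlongrightarrow> (\<integral>x. h x \<partial>lborel)) at_top"
proof -
  define H where "H = (\<lambda>y. LINT x:{..y}|lborel. h x)"
  have [measurable]: "h \<in> borel_measurable borel" using cont by (rule borel_measurable_continuous_onI)
  have si: "set_integrable lborel A h" if "A \<in> sets borel" for A
    using int that set_integrable_subset[of lborel UNIV h A] by (simp add: set_integrable_def)
  \<comment> \<open>Increments of \<open>H\<close> are integrals over compact intervals, to which
    the fundamental theorem of calculus applies.\<close>
  have split: "H y = H a + integral {a..y} h" if "a \<le> y" for a y
  proof -
    have "{..y} = {..a} \<union> {a<..y}" using that by auto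
    then have "H y = H a + (LINT x:{a<..y}|lborel. h x)"
      unfolding H_def by (simp only:) (rule set_integral_Un; auto intro: si)
    also have "(LINT x:{a<..y}|lborel. h x) = (LINT x:{a..y}|lborel. h x)"
      by (rule set_integral_discrete_difference[of "{a}"]) auto
    also have "\<dots> = integral {a..y} h" by (intro set_borel_integral_eq_integral si) simp
    finally show ?thesis .
  qed
  have "(H has_real_derivative h x) (at x)" for x
  proof -
    have "((\<lambda>y. H (x - 1) + integral {x - 1..y} h) has_real_derivative h x) (at x within {x-1..x+1})"
      by (rule derivative_eq_intros integral_has_real_derivative continuous_on_subset[OF cont] | simp)+
    then have "(H has_real_derivative h x) (at x within {x-1..x+1})"
    proof (rule has_field_derivative_transform_within[of _ _ _ _ 1])
      fix y assume "y \<in> {x - 1..x + 1}"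
      then show "H (x - 1) + integral {x - 1..y} h = H y" using split[of "x - 1" y] by simp
    qed auto
    then show ?thesis using at_within_interior[of x "{x-1..x+1}"] by simp
  qed
  moreover have "(H \<longlongrightarrow> (\<integral>x. h x \<partial>lborel)) at_top"
    unfolding H_def set_lebesgue_integral_def
  proof (rule integral_dominated_convergence_at_top[where w = "\<lambda>x. norm (h x)"])
    show "AE x in lborel. ((\<lambda>i. indicat_real {..i} x *\<^sub>R h x) \<longlongrightarrow> h x) at_top"
    proof (rule AE_I2)
      fix x :: real
      show "((\<lambda>i. indicat_real {..i} x *\<^sub>R h x) \<longlongrightarrow> h x) at_top"
        by (rule tendsto_eventually) (auto intro: eventually_mono[OF eventually_ge_at_top[of x]])
    qed
  qed (use int in \<open>auto simp: indicator_def\<close>)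
  moreover have "(H \<longlongrightarrow> 0) at_bot"
    unfolding filterlim_at_bot_mirror H_def set_lebesgue_integral_def
  proof -
    have "((\<lambda>i. \<integral>x. indicat_real {..- i} x *\<^sub>R h x \<partial>lborel) \<longlongrightarrow> (\<integral>x. 0 \<partial>(lborel :: real measure))) at_top"
    proof (rule integral_dominated_convergence_at_top[where w = "\<lambda>x. norm (h x)"])
      show "AE x in lborel. ((\<lambda>i. indicat_real {..- i} x *\<^sub>R h x) \<longlongrightarrow> 0) at_top"
      proof (rule AE_I2)
        fix x :: real
        show "((\<lambda>i. indicat_real {..- i} x *\<^sub>R h x) \<longlongrightarrow> 0) at_top"
          by (rule tendsto_eventually) (auto intro: eventually_mono[OF eventually_gt_at_top[of "-x"]])
      qed
    qed (use int in \<open>auto simp: indicator_def\<close>)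
    then show "((\<lambda>i. \<integral>x. indicat_real {..- i} x *\<^sub>R h x \<partial>lborel) \<longlongrightarrow> 0) at_top" by simp
  qed
  ultimately show thesis using that by blast
qed

text \<open>Outside [0, 1] the graph lies above the line through its points at 0 and 1; inside,
  above the line through its points at -1 and 0. The two absolute values absorb the change of
  slope.\<close>

lemma convex_on_UNIV_imp_affine_minorant:
  fixes f :: "real \<Rightarrow> real"
  assumes "convex_on UNIV f"
  obtains a b where "\<And>y. f y \<ge> a * y + b"
proof -
  define a where "a = f 1 - f 0"
  have "f y \<ge> a * y + (f 0 - \<bar>f 0 - f (-1)\<bar> - \<bar>a\<bar>)" for y
  proof -
    consider "y \<le> 0" | "0 < y" "y < 1" | "y \<ge> 1" by linarith
    then show ?thesis
    proof cases
      case 1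
      then have "(f y - f 1) / (y - 1) \<le> a"
        using convex_on_slope_le(2)[OF assms, of y 1 0] unfolding a_def by (cases "y = 0") auto
      then have "f y - f 1 \<ge> a * (y - 1)" using 1 by (simp add: divide_le_eq)
      then show ?thesis unfolding a_def by (simp add: algebra_simps)
    next
      case 2
      have "(f (-1) - f 0) / (-1 - 0) \<le> (f 0 - f y) / (0 - y)"
        using order_trans[OF convex_on_slope_le(1)[OF assms, of "-1" y 0] convex_on_slope_le(2)[OF assms, of "-1" y 0]] 2
        by simp
      moreover have "(f 0 - f y) / (0 - y) = (f y - f 0) / y" using 2 by (simp add: divide_simps)
      ultimately have "f 0 - f (-1) \<le> (f y - f 0) / y" by simp
      then have "f y - f 0 \<ge> (f 0 - f (-1)) * y" using 2 by (simp add: le_divide_eq)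
      moreover have "\<bar>c * y\<bar> \<le> \<bar>c\<bar>" for c
        using 2 mult_left_mono[of y 1 "\<bar>c\<bar>"] by (simp add: abs_mult)
      from this[of "f 0 - f (-1)"] this[of a]
      have "(f 0 - f (-1)) * y \<ge> - \<bar>f 0 - f (-1)\<bar>" "a * y \<le> \<bar>a\<bar>" by linarith+
      ultimately show ?thesis by linarith
    next
      case 3
      have "(f 0 - f 1) / (0 - 1) \<le> (f 0 - f y) / (0 - y)"
        using convex_on_slope_le(1)[OF assms, of 0 y 1] 3 by (cases "y = 1") auto
      moreover have "(f 0 - f y) / (0 - y) = (f y - f 0) / y" using 3 by (simp add: divide_simps)
      ultimately have "a \<le> (f y - f 0) / y" by (simp add: a_def)
      then have "f y - f 0 \<ge> a * y" using 3 by (simp add: le_divide_eq)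
      then show ?thesis by linarith
    qed
  qed
  then show thesis using that by blast
qed

text \<open>An affine minorant bounds the integrand by a multiple of the Gaussian density with mean
  \<open>- a\<close>, by completing the square.\<close>

lemma integrable_exp_convex_std_normal:
  fixes f :: "real \<Rightarrow> real"
  assumes "convex_on UNIV f"
  shows "integrable lborel (\<lambda>y. exp (- f y) * std_normal_density y)"
proof -
  obtain a b where ab: "\<And>y. f y \<ge> a * y + b"
    using convex_on_UNIV_imp_affine_minorant[OF assms] by blast
  have [measurable]: "f \<in> borel_measurable borel"
    using assms by (intro borel_measurable_continuous_onI convex_on_continuous) auto
  show ?thesis
  proof (rule Bochner_Integration.integrable_bound)
    show "integrable lborel (\<lambda>y. exp (a\<^sup>2 / 2 - b) * normal_density (- a) 1 y)" by simp
    show "AE y in lborel. norm (exp (- f y) * std_normal_density y)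
        \<le> norm (exp (a\<^sup>2 / 2 - b) * normal_density (- a) 1 y)"
    proof (rule AE_I2)
      fix y :: real
      have "exp (- f y) * std_normal_density y \<le> exp (- a * y - b) * std_normal_density y"
        using ab[of y] by (intro mult_right_mono) auto
      also have "\<dots> = exp (a\<^sup>2 / 2 - b) * normal_density (- a) 1 y"
        unfolding normal_density_def
        by (simp add: exp_add[symmetric] power2_eq_square field_simps)
      finally show "norm (exp (- f y) * std_normal_density y)
        \<le> norm (exp (a\<^sup>2 / 2 - b) * normal_density (- a) 1 y)" by simp
    qed
  qed simp
qed

section \<open>Monotone transport of the Gaussian measure\<close>

lemma filterlim_add_const_at_top: "filterlim (\<lambda>y::real. y + d) at_top at_top"
  by (rule filterlim_at_top_mono[OF filterlim_tendsto_add_at_top[OF tendsto_const[of d] filterlim_ident]]) simp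

lemma filterlim_add_const_at_bot: "filterlim (\<lambda>y::real. y + d) at_bot at_bot"
  using filterlim_tendsto_add_at_bot_iff[OF tendsto_const[of d at_bot], of "\<lambda>y. y"]
  by (simp add: filterlim_ident add.commute)

text \<open>Makes a distribution function a bijection onto the open interval between its limits, so
  that quantile maps exist.\<close>

lemma increasing_with_limits:
  fixes H h :: "real \<Rightarrow> real"
  assumes der: "\<And>x. (H has_real_derivative h x) (at x)" and pos: "\<And>x. h x > 0"
    and bot: "(H \<longlongrightarrow> l) at_bot" and top: "(H \<longlongrightarrow> u) at_top"
  shows "strict_mono H" "l < H x" "H x < u" "range H = {l<..<u}"
proof -
  show mono: "strict_mono H"
  proof (rule strict_monoI)
    fix x y :: real assume "x < y"
    then show "H x < H y" by (rule DERIV_pos_imp_increasing) (use der pos in \<open>auto intro!: exI\<close>)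
  qed
  have less: "l < H x" for x
  proof -
    have "l \<le> H (x - 1)"
      using bot by (rule tendsto_upperbound)
        (auto simp: eventually_at_bot_linorder strict_mono_less_eq[OF mono] intro!: exI[of _ "x - 1"])
    also have "\<dots> < H x" using mono by (simp add: strict_mono_less)
    finally show ?thesis .
  qed
  moreover have greater: "H x < u" for x
  proof -
    have "H x < H (x + 1)" using mono by (simp add: strict_mono_less)
    also have "H (x + 1) \<le> u"
      using top by (rule tendsto_lowerbound)
        (auto simp: eventually_at_top_linorder strict_mono_less_eq[OF mono] intro!: exI[of _ "x + 1"])
    finally show ?thesis .
  qed
  ultimately show "l < H x" "H x < u" by auto
  show "range H = {l<..<u}"
  proof (intro equalityI subsetI)
    fix v assume v: "v \<in> {l<..<u}"
    have "\<forall>\<^sub>F y in at_bot. H y < v" using order_tendstoD(2)[OF bot] v by simp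
    then obtain a where a: "H a < v" by (auto simp: eventually_at_bot_linorder)
    have "\<forall>\<^sub>F y in at_top. v < H y" using order_tendstoD(1)[OF top] v by simp
    then obtain b where b: "v < H b" by (auto simp: eventually_at_top_linorder)
    have "a \<le> b"
      using a b strict_mono_less[OF mono, of a b] by linarith
    have "\<exists>y\<ge>a. y \<le> b \<and> H y = v"
      by (rule IVT') (use a b \<open>a \<le> b\<close> der in \<open>auto intro!: continuous_at_imp_continuous_on DERIV_isCont\<close>)
    then show "v \<in> range H" by auto
  qed (use less greater in auto)
qed

text \<open>The transport map is \<open>1\<close>-Lipschitz (the one-dimensional case of Caffarelli's theorem): if its
  derivative exceeded \<open>1\<close> at some point, then the density of the image measure would lie below a
  translate of the Gaussian density having the same quantile there; as the quotient of the two is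
  log-concave, this would persist on one whole side of the point and contradict equality of masses.\<close>

lemma gaussian_transport_contraction:
  fixes f :: "real \<Rightarrow> real"
  assumes f: "convex_on UNIV f"
  defines "w \<equiv> \<lambda>y. exp (- f y) * std_normal_density y"
  defines "Z \<equiv> \<integral>y. w y \<partial>lborel"
  obtains T D where "\<And>x. (T has_real_derivative D x) (at x)" "\<And>x. 0 < D x" "\<And>x. D x \<le> 1"
    "\<And>x. w (T x) * D x = Z * std_normal_density x"
proof -
  have contf: "continuous_on UNIV f" using f by (intro convex_on_continuous) auto
  have contN: "continuous_on UNIV std_normal_density"
    unfolding normal_density_def by (intro continuous_intros) auto
  have contw: "continuous_on UNIV w"
    unfolding w_def by (intro continuous_intros contf contN)
  have wpos: "w y > 0" for y unfolding w_def by (simp add: normal_density_pos)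
  obtain H where H: "\<And>x. (H has_real_derivative w x) (at x)" "(H \<longlongrightarrow> 0) at_bot" "(H \<longlongrightarrow> Z) at_top"
    using cdf_of_density[OF contw] integrable_exp_convex_std_normal[OF f] unfolding w_def Z_def by blast
  note Hp = increasing_with_limits[OF H(1) wpos H(2,3)]
  have Z: "Z > 0" using Hp(2,3)[of 0] by linarith
  obtain K0 where K0: "\<And>x. (K0 has_real_derivative std_normal_density x) (at x)"
      "(K0 \<longlongrightarrow> 0) at_bot" "(K0 \<longlongrightarrow> 1) at_top"
    using cdf_of_density[OF contN] by auto
  define K where "K = (\<lambda>x. Z * K0 x)"
  have K: "(K has_real_derivative Z * std_normal_density x) (at x)" for x
    unfolding K_def by (intro DERIV_cmult K0)
  have Klim: "(K \<longlongrightarrow> 0) at_bot" "(K \<longlongrightarrow> Z) at_top"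
    unfolding K_def using tendsto_mult_left[OF K0(2), of Z] tendsto_mult_left[OF K0(3), of Z] by auto
  have Npos: "Z * std_normal_density x > 0" for x using Z by (simp add: normal_density_pos)
  note Kp = increasing_with_limits[OF K Npos Klim]
  \<comment> \<open>\<open>G\<close> is the quantile function of \<open>H\<close>. Since
    \<open>H\<close> and \<open>K\<close> have the same total mass \<open>Z\<close>,
    \<open>T\<close> satisfies \<open>H (T x) = K x\<close> everywhere, and differentiating this
    gives \<open>D\<close>.\<close>
  define G where "G = inv H"
  have G: "G (H y) = y" for y unfolding G_def using Hp(1) by (simp add: strict_mono_imp_inj_on)
  define T where "T = (\<lambda>x. G (K x))"
  have HT: "H (T x) = K x" for x
    unfolding T_def G_def using Kp(4) Hp(4) by (intro f_inv_into_f) auto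
  define D where "D = (\<lambda>x. Z * std_normal_density x / w (T x))"
  have "(T has_real_derivative D x) (at x)" for x
  proof -
    have "(G has_derivative (\<lambda>u. inverse (w (T x)) * u)) (at (H (T x)))"
      using H(1)[of "T x"] wpos[of "T x"] G H(1)
      by (intro has_derivative_inverse_strong[of UNIV "T x" H G "\<lambda>u. w (T x) * u"])
         (auto intro!: continuous_at_imp_continuous_on DERIV_isCont simp: has_field_derivative_def fun_eq_iff)
    then have "(G has_real_derivative inverse (w (T x))) (at (K x))" by (simp add: HT has_field_derivative_def)
    from DERIV_chain2[OF this K] show ?thesis unfolding T_def[symmetric] D_def by (simp add: field_simps)
  qed
  moreover have "D x > 0" for x unfolding D_def using Npos wpos by simp
  moreover have "w (T x) * D x = Z * std_normal_density x" for x
    unfolding D_def using wpos[of "T x"] by simp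
  moreover have "D x \<le> 1" for x
  proof (rule ccontr)
    assume "\<not> D x \<le> 1"
    then have less: "w (T x) < Z * std_normal_density x"
      unfolding D_def using wpos[of "T x"] by (simp add: field_simps)
    \<comment> \<open>Since \<open>T x + d = x\<close>, the Gaussian density scaled by
      \<open>Z\<close> and translated by \<open>d\<close> has the same mass below \<open>T x\<close>
      as \<open>w\<close>. \<open>e\<close> is the logarithm of its quotient by \<open>w\<close>:
      \<open>f\<close> plus an affine function, hence convex.\<close>
    define d where "d = x - T x"
    define e where "e = (\<lambda>y. f y + (- d * y + (ln Z - d\<^sup>2 / 2)))"
    have e: "w y < Z * std_normal_density (y + d) \<longleftrightarrow> e y > 0" for y
    proof -
      have "w y = exp (- f y - y\<^sup>2 / 2) * (1 / sqrt (2 * pi))"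
        unfolding w_def std_normal_density_def by (simp add: exp_add[symmetric] mult_ac)
      moreover have "Z * std_normal_density (y + d) = exp (ln Z - (y + d)\<^sup>2 / 2) * (1 / sqrt (2 * pi))"
        unfolding std_normal_density_def diff_conv_add_uminus exp_add using Z by simp
      ultimately have "w y < Z * std_normal_density (y + d) \<longleftrightarrow>
        - f y - y\<^sup>2 / 2 < ln Z - (y + d)\<^sup>2 / 2" by (simp add: divide_less_cancel)
      also have "\<dots> \<longleftrightarrow> e y > 0" unfolding e_def by (auto simp: power2_eq_square field_simps)
      finally show ?thesis .
    qed
    have conve: "convex_on UNIV e"
    proof -
      have "convex_on UNIV (\<lambda>y. - d * y + (ln Z - d\<^sup>2 / 2))"
      proof (rule convex_onI)
        fix t x y :: real
        let ?h = "\<lambda>y. - d * y + (ln Z - d\<^sup>2 / 2)"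
        have "?h ((1 - t) *\<^sub>R x + t *\<^sub>R y) = (1 - t) * ?h x + t * ?h y" by (simp add: field_simps)
        then show "?h ((1 - t) *\<^sub>R x + t *\<^sub>R y) \<le> (1 - t) * ?h x + t * ?h y" by simp
      qed simp
      then show ?thesis unfolding e_def by (rule convex_on_add[OF f])
    qed
    have e0: "e (T x) > 0" using less e[of "T x"] by (simp add: d_def)
    \<comment> \<open>\<open>V\<close> is the difference of the two distribution functions. It
      vanishes at \<open>T x\<close> and tends to 0 at both ends, so it cannot be strictly
      increasing on a whole side of \<open>T x\<close>.\<close>
    define V where "V = (\<lambda>y. K (y + d) - H y)"
    have V: "(V has_real_derivative Z * std_normal_density (y + d) - w y) (at y)" for y
      unfolding V_def using K[of "y + d"] by (intro DERIV_diff H) (simp only: DERIV_shift)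
    have V0: "V (T x) = 0" unfolding V_def d_def by (simp add: HT)
    have Vpos: "\<exists>y. (V has_real_derivative y) (at z) \<and> y > 0" if "e z > 0" for z
      using V[of z] e[of z] that by (intro exI[of _ "Z * std_normal_density (z + d) - w z"]) auto
    have "(\<forall>y\<le>T x. e y > 0) \<or> (\<forall>y\<ge>T x. e y > 0)"
    proof (rule ccontr)
      assume "\<not> ?thesis"
      then obtain a b where ab: "a \<le> T x" "e a \<le> 0" "T x \<le> b" "e b \<le> 0" by (auto simp: not_less)
      have "e (T x) \<le> max (e a) (e b)"
        by (rule convex_on_le_max[of a b]) (use ab conve in \<open>auto intro: convex_on_subset\<close>)
      then show False using ab e0 by simp
    qed
    then show False
    proof
      assume *: "\<forall>y\<le>T x. e y > 0"
      have mono: "V y < V z" if "y < z" "z \<le> T x" for y z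
        using that * Vpos by (intro DERIV_pos_imp_increasing[OF that(1)]) auto
      have "(V \<longlongrightarrow> 0 - 0) at_bot"
        unfolding V_def
      proof (intro tendsto_diff H)
        show "((\<lambda>y. K (y + d)) \<longlongrightarrow> 0) at_bot"
          by (rule filterlim_compose[OF Klim(1)]) (rule filterlim_add_const_at_bot)
      qed
      then have "0 - 0 \<le> V (T x - 1)"
        by (rule tendsto_upperbound)
           (auto simp: eventually_at_bot_linorder intro!: exI[of _ "T x - 2"] less_imp_le[OF mono])
      also have "\<dots> < V (T x)" by (rule mono) auto
      finally show False using V0 by simp
    next
      assume *: "\<forall>y\<ge>T x. e y > 0"
      have mono: "V y < V z" if "y < z" "T x \<le> y" for y z
        using that * Vpos by (intro DERIV_pos_imp_increasing[OF that(1)]) auto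
      have "(V \<longlongrightarrow> Z - Z) at_top"
        unfolding V_def
      proof (intro tendsto_diff H)
        show "((\<lambda>y. K (y + d)) \<longlongrightarrow> Z) at_top"
          by (rule filterlim_compose[OF Klim(2)]) (rule filterlim_add_const_at_top)
      qed
      then have "V (T x + 1) \<le> Z - Z"
        by (rule tendsto_lowerbound)
           (auto simp: eventually_at_top_linorder intro!: exI[of _ "T x + 2"] less_imp_le[OF mono])
      moreover have "V (T x) < V (T x + 1)" by (rule mono) auto
      ultimately show False using V0 by simp
    qed
  qed
  ultimately show thesis using that by blast
qed

section \<open>Free energies in one dimension\<close>

text \<open>Free energy at inverse temperature \<open>m\<close> over the Gaussian reference measure:
  a soft minimum of \<open>f\<close>, corresponding to \<open>Phi\<close> at
  \<open>- m\<close>.\<close>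

definition free_energy :: "real \<Rightarrow> (real \<Rightarrow> real) \<Rightarrow> real" where
  "free_energy m f = - ln (\<integral>y. exp (- (m * f y)) * std_normal_density y \<partial>lborel) / m"

lemma std_normal_partition_pos:
  fixes f :: "real \<Rightarrow> real"
  assumes "convex_on UNIV f"
  shows "0 < (\<integral>y. exp (- f y) * std_normal_density y \<partial>lborel)"
proof -
  let ?w = "\<lambda>y. exp (- f y) * std_normal_density y"
  have contf: "continuous_on UNIV f" using assms by (intro convex_on_continuous) auto
  have "continuous_on UNIV ?w"
    unfolding normal_density_def by (intro continuous_intros contf) auto
  then obtain H where H: "\<And>x. (H has_real_derivative ?w x) (at x)" "(H \<longlongrightarrow> 0) at_bot"
      "(H \<longlongrightarrow> (\<integral>y. ?w y \<partial>lborel)) at_top"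
    using cdf_of_density[OF _ integrable_exp_convex_std_normal[OF assms]] by blast
  have "?w y > 0" for y by (simp add: normal_density_pos)
  from increasing_with_limits(2,3)[OF H(1) this H(2,3), of 0] show ?thesis by linarith
qed

text \<open>Logarithmic form of the change of variables equation for a transport map with value
  \<open>t\<close> and derivative \<open>d\<close> at \<open>x\<close>.\<close>

lemma gaussian_jacobian_log:
  assumes "exp u * std_normal_density t * d = z * std_normal_density x" "d > 0" "z > 0"
  shows "u - t\<^sup>2 / 2 + ln d = ln z - x\<^sup>2 / 2"
proof -
  have "exp (u - t\<^sup>2 / 2 + ln d) * (1 / sqrt (2 * pi)) = exp u * std_normal_density t * d"
    unfolding std_normal_density_def diff_conv_add_uminus exp_add using assms by simp
  also have "\<dots> = exp (ln z - x\<^sup>2 / 2) * (1 / sqrt (2 * pi))"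
    unfolding assms(1) unfolding std_normal_density_def diff_conv_add_uminus exp_add using assms by simp
  finally show ?thesis by simp
qed

lemma exp_mult_std_normal_density:
  "exp u * std_normal_density x * exp v = exp (u - x\<^sup>2 / 2 + v) / sqrt (2 * pi)"
  unfolding std_normal_density_def diff_conv_add_uminus exp_add by simp

text \<open>The weights \<open>a\<close>, \<open>b\<close> do not sum to \<open>1\<close>, so the first-order terms \<open>x (T i - x) - (D i - 1)\<close> do not
  cancel pointwise. They survive on the right-hand side, where, multiplied by the Gaussian density,
  they form a total derivative.\<close>

lemma free_energy_pointwise:
  fixes m0 m1 s x T0 T1 D0 D1 F0 F1 F Z0 Z1 :: real
  assumes m: "m0 > 0" "m1 > 0" and s: "0 \<le> s" "s \<le> 1"
    and D0: "0 < D0" "D0 \<le> 1" and D1: "0 < D1" "D1 \<le> 1"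
    and Z: "Z0 > 0" "Z1 > 0"
    and w0: "exp (- (m0 * F0)) * std_normal_density T0 * D0 = Z0 * std_normal_density x"
    and w1: "exp (- (m1 * F1)) * std_normal_density T1 * D1 = Z1 * std_normal_density x"
    and F: "F \<le> (1 - s) * F0 + s * F1"
  defines "m \<equiv> (1 - s) * m0 + s * m1"
  defines "a \<equiv> (1 - s) * m / m0" and "b \<equiv> s * m / m1"
  defines "T \<equiv> (1 - s) * T0 + s * T1" and "D \<equiv> (1 - s) * D0 + s * D1"
  shows "exp (a * ln Z0 + b * ln Z1) * std_normal_density x *
      (1 + x * (a * (T0 - x) + b * (T1 - x) - (T - x)) - (a * (D0 - 1) + b * (D1 - 1) - (D - 1)))
    \<le> exp (- (m * F)) * std_normal_density T * D"
proof -
  let ?Q = "x * (a * (T0 - x) + b * (T1 - x) - (T - x)) - (a * (D0 - 1) + b * (D1 - 1) - (D - 1))"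
  have mpos: "m > 0"
    unfolding m_def using convex_bound_lt[of "- m0" 0 "- m1" "1 - s" s] m s by simp
  have Dpos: "D > 0"
    unfolding D_def using convex_bound_lt[of "- D0" 0 "- D1" "1 - s" s] D0 D1 s by simp
  have e0: "m0 * F0 = - ln Z0 + x\<^sup>2 / 2 - T0\<^sup>2 / 2 + ln D0"
    using gaussian_jacobian_log[OF w0 D0(1) Z(1)] by linarith
  have e1: "m1 * F1 = - ln Z1 + x\<^sup>2 / 2 - T1\<^sup>2 / 2 + ln D1"
    using gaussian_jacobian_log[OF w1 D1(1) Z(2)] by linarith
  have "m * F \<le> m * ((1 - s) * F0 + s * F1)" using F mpos by simp
  also have "\<dots> = a * (m0 * F0) + b * (m1 * F1)"
    unfolding a_def b_def using m by (simp add: field_simps)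
  finally have mF: "m * F \<le> a * (- ln Z0 + x\<^sup>2 / 2 - T0\<^sup>2 / 2 + ln D0) + b * (- ln Z1 + x\<^sup>2 / 2 - T1\<^sup>2 / 2 + ln D1)"
    unfolding e0 e1 .
  have sq: "(T - x)\<^sup>2 \<le> a * (T0 - x)\<^sup>2 + b * (T1 - x)\<^sup>2"
  proof -
    have "T - x = (1 - s) * (T0 - x) + s * (T1 - x)" unfolding T_def by (simp add: algebra_simps)
    then show ?thesis unfolding a_def b_def m_def using perspective_square[OF m s] by metis
  qed
  \<comment> \<open>The bounds \<open>D0 \<le> 1\<close> and \<open>D1 \<le> 1\<close> place
    \<open>D0 - 1\<close> and \<open>D1 - 1\<close> in (-1, 0], where the joint convexity of the
    cost holds.\<close>
  have ln: "D - 1 - ln D \<le> a * (D0 - 1 - ln D0) + b * (D1 - 1 - ln D1)"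
  proof -
    have e: "(1 - s) * (D0 - 1) + s * (D1 - 1) = D - 1" unfolding D_def by (simp add: algebra_simps)
    show ?thesis
      using perspective_diff_ln[OF m s, of "D0 - 1" "D1 - 1", folded m_def, folded a_def b_def] D0 D1
      unfolding e by simp
  qed
  define P where "P = a * (ln Z0 - x\<^sup>2 / 2 + T0\<^sup>2 / 2 - ln D0) + b * (ln Z1 - x\<^sup>2 / 2 + T1\<^sup>2 / 2 - ln D1)"
  have "a * (- ln Z0 + x\<^sup>2 / 2 - T0\<^sup>2 / 2 + ln D0) + b * (- ln Z1 + x\<^sup>2 / 2 - T1\<^sup>2 / 2 + ln D1) = - P"
    unfolding P_def by (simp add: algebra_simps)
  with mF have "P \<le> - (m * F)" by simp
  \<comment> \<open>Writing \<open>T^2 - x^2 = (T - x)^2 + 2 * x * (T - x)\<close> and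
    \<open>ln D = (D - 1) - (D - 1 - ln D)\<close>, and likewise for both given maps, separates the
    costs from the first-order terms in \<open>?Q\<close>.\<close>
  moreover have "P - T\<^sup>2 / 2 + ln D
      - (a * ln Z0 + b * ln Z1 - x\<^sup>2 / 2 + ?Q)
    = (a * (T0 - x)\<^sup>2 + b * (T1 - x)\<^sup>2 - (T - x)\<^sup>2) / 2
      + (a * (D0 - 1 - ln D0) + b * (D1 - 1 - ln D1) - (D - 1 - ln D))"
    unfolding P_def by (simp add: power2_eq_square field_simps)
  ultimately have main: "a * ln Z0 + b * ln Z1 - x\<^sup>2 / 2 + ?Q \<le> - (m * F) - T\<^sup>2 / 2 + ln D"
    using sq ln by argo
  \<comment> \<open>Replacing \<open>exp ?Q\<close> by \<open>1 + ?Q\<close> makes the bound linear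
    in the maps and their derivatives, hence explicitly integrable in \<open>x\<close>.\<close>
  have "exp (a * ln Z0 + b * ln Z1) * std_normal_density x * (1 + ?Q)
    \<le> exp (a * ln Z0 + b * ln Z1) * std_normal_density x * exp ?Q"
    using exp_ge_add_one_self[of ?Q] by (intro mult_left_mono) (auto simp only: add_diff_eq, auto)
  also have "\<dots> = exp (a * ln Z0 + b * ln Z1 - x\<^sup>2 / 2 + ?Q) / sqrt (2 * pi)"
    by (rule exp_mult_std_normal_density)
  also have "\<dots> \<le> exp (- (m * F) - T\<^sup>2 / 2 + ln D) / sqrt (2 * pi)"
    using main by (intro divide_right_mono) auto
  also have "\<dots> = exp (- (m * F)) * std_normal_density T * D"
    using exp_mult_std_normal_density[of "- (m * F)" T "ln D"] Dpos by simp
  finally show ?thesis by (simp only: add_diff_eq)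
qed

lemma deriv_std_normal_density:
  "(std_normal_density has_real_derivative - x * std_normal_density x) (at x)"
proof -
  have "((\<lambda>x. exp (- x\<^sup>2 / 2)) has_real_derivative - x * exp (- x\<^sup>2 / 2)) (at x)"
    by (auto intro!: derivative_eq_intros)
  from DERIV_cmult[OF this, of "1 / sqrt (2 * pi)"] show ?thesis
    unfolding std_normal_density_def[abs_def] by (simp add: mult_ac)
qed

text \<open>Disposes of the boundary terms when a total derivative is integrated over the line. The
  lower end is handled by reflection, since the density is even.\<close>

lemma linear_growth_mult_std_normal_tendsto_0:
  fixes B :: "real \<Rightarrow> real"
  assumes "\<And>x. \<bar>B x\<bar> \<le> A + C * \<bar>x\<bar>"
  shows "((\<lambda>x. B x * std_normal_density x) \<longlongrightarrow> 0) at_top"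
    "((\<lambda>x. B (- x) * std_normal_density (- x)) \<longlongrightarrow> 0) at_top"
proof -
  have *: "((\<lambda>x. B' x * std_normal_density x) \<longlongrightarrow> 0) at_top" if "\<And>x. \<bar>B' x\<bar> \<le> A + C * \<bar>x\<bar>" for B' :: "real \<Rightarrow> real"
  proof (rule Lim_null_comparison)
    show "\<forall>\<^sub>F x in at_top. norm (B' x * std_normal_density x) \<le> (A + C * x) * std_normal_density x"
      using eventually_ge_at_top[of 0]
    proof eventually_elim
      case (elim x)
      then show ?case using that[of x] by (auto simp: abs_mult intro!: mult_right_mono)
    qed
    show "((\<lambda>x. (A + C * x) * std_normal_density x) \<longlongrightarrow> 0) at_top"
      unfolding std_normal_density_def[abs_def] by real_asymp
  qed
  show "((\<lambda>x. B x * std_normal_density x) \<longlongrightarrow> 0) at_top" using assms by (rule *)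
  show "((\<lambda>x. B (- x) * std_normal_density (- x)) \<longlongrightarrow> 0) at_top"
    using *[of "\<lambda>x. B (- x)"] assms[of "- _"] by (simp add: normal_density_def)
qed

text \<open>Substituting the interpolated map \<open>T\<close> in the partition function of
  \<open>F\<close> and applying \<open>free_energy_pointwise\<close> leaves \<open>exp C\<close>
  times the integral of the Gaussian density plus a total derivative. Hence
  \<open>exp C \<le> Z m F\<close>, whose logarithm is the claim.\<close>

theorem free_energy_three_functions:
  fixes F0 F1 F :: "real \<Rightarrow> real"
  assumes conv: "convex_on UNIV F0" "convex_on UNIV F1" "convex_on UNIV F"
    and m: "m0 > 0" "m1 > 0" and s: "0 \<le> s" "s \<le> 1"
    and le: "\<And>x y. F ((1 - s) * x + s * y) \<le> (1 - s) * F0 x + s * F1 y"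
  shows "free_energy ((1 - s) * m0 + s * m1) F \<le> (1 - s) * free_energy m0 F0 + s * free_energy m1 F1"
proof -
  define m where "m = (1 - s) * m0 + s * m1"
  have mpos: "m > 0"
    unfolding m_def using convex_bound_lt[of "- m0" 0 "- m1" "1 - s" s] m s by simp
  define w where "w = (\<lambda>m (f::real \<Rightarrow> real) y. exp (- (m * f y)) * std_normal_density y)"
  define Z where "Z = (\<lambda>m f. \<integral>y. w m f y \<partial>lborel)"
  have sc: "convex_on UNIV (\<lambda>y. c * f y)" if "c > 0" "convex_on UNIV f" for c and f :: "real \<Rightarrow> real"
    using that by (intro convex_on_cmul) auto
  have Zpos: "Z c f > 0" if "c > 0" "convex_on UNIV f" for c f
    unfolding Z_def w_def by (rule std_normal_partition_pos[OF sc[OF that]])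
  obtain T0 D0 where T0: "\<And>x. (T0 has_real_derivative D0 x) (at x)" "\<And>x. 0 < D0 x" "\<And>x. D0 x \<le> 1"
    "\<And>x. w m0 F0 (T0 x) * D0 x = Z m0 F0 * std_normal_density x"
    using gaussian_transport_contraction[OF sc[OF m(1) conv(1)]] unfolding w_def Z_def by blast
  obtain T1 D1 where T1: "\<And>x. (T1 has_real_derivative D1 x) (at x)" "\<And>x. 0 < D1 x" "\<And>x. D1 x \<le> 1"
    "\<And>x. w m1 F1 (T1 x) * D1 x = Z m1 F1 * std_normal_density x"
    using gaussian_transport_contraction[OF sc[OF m(2) conv(2)]] unfolding w_def Z_def by blast
  define a b where "a = (1 - s) * m / m0" and "b = s * m / m1"
  have ab: "a \<ge> 0" "b \<ge> 0" unfolding a_def b_def using m s mpos by auto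
  define C where "C = a * ln (Z m0 F0) + b * ln (Z m1 F1)"
  define T D where "T = (\<lambda>x. (1 - s) * T0 x + s * T1 x)" and "D = (\<lambda>x. (1 - s) * D0 x + s * D1 x)"
  define B B' where "B = (\<lambda>x. a * (T0 x - x) + b * (T1 x - x) - (T x - x))"
    and "B' = (\<lambda>x. a * (D0 x - 1) + b * (D1 x - 1) - (D x - 1))"
  have pw: "exp C * std_normal_density x * (1 + x * B x - B' x) \<le> w m F (T x) * D x" for x
    unfolding C_def B_def B'_def w_def T_def D_def a_def b_def m_def
    by (rule free_energy_pointwise)
       (use m s T0 T1 Zpos conv le in \<open>auto simp: w_def\<close>)
  have contF: "continuous_on UNIV F" using conv by (intro convex_on_continuous) auto
  have "continuous_on UNIV (w m F)"
    unfolding w_def normal_density_def by (intro continuous_intros contF) auto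
  then obtain H where H: "\<And>x. (H has_real_derivative w m F x) (at x)" "(H \<longlongrightarrow> 0) at_bot" "(H \<longlongrightarrow> Z m F) at_top"
    using cdf_of_density integrable_exp_convex_std_normal[OF sc[OF mpos conv(3)]] unfolding w_def Z_def by blast
  have "w m F y > 0" for y unfolding w_def by (simp add: normal_density_pos)
  note Hp = increasing_with_limits[OF H(1) this H(2,3)]
  have "continuous_on UNIV std_normal_density"
    unfolding normal_density_def by (intro continuous_intros) auto
  then obtain K where K: "\<And>x. (K has_real_derivative std_normal_density x) (at x)" "(K \<longlongrightarrow> 0) at_bot" "(K \<longlongrightarrow> 1) at_top"
    using cdf_of_density[of std_normal_density] by auto
  \<comment> \<open>Primitives are compared instead of integrals: \<open>H (T x)\<close> is a
    primitive of the substituted integrand, the subtracted term one of its lower bound. Monotonicity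
    of \<open>L\<close> from \<open>- N\<close> to \<open>N\<close> replaces the change of
    variables.\<close>
  define L where "L = (\<lambda>x. H (T x) - exp C * (K x - B x * std_normal_density x))"
  have dT: "(T has_real_derivative D x) (at x)" for x
    unfolding T_def D_def by (auto intro!: derivative_eq_intros T0(1) T1(1))
  have dB: "(B has_real_derivative B' x) (at x)" for x
    unfolding B_def B'_def by (auto intro!: derivative_eq_intros T0(1) T1(1) dT)
  have dL: "(L has_real_derivative w m F (T x) * D x - exp C * std_normal_density x * (1 + x * B x - B' x)) (at x)" for x
    unfolding L_def
    by (auto intro!: derivative_eq_intros DERIV_chain2[OF H(1)] dT K dB deriv_std_normal_density simp: algebra_simps)
  have Lmono: "L x \<le> L y" if "x \<le> y" for x y
    by (rule DERIV_nonneg_imp_nondecreasing[OF that]) (use dL pw in \<open>auto intro!: exI\<close>)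
  \<comment> \<open>Derivatives in (0, 1] make the maps 1-Lipschitz, so that \<open>B\<close> grows
    at most linearly.\<close>
  have bound: "\<bar>T x - x\<bar> \<le> \<bar>T 0\<bar> + 2 * \<bar>x\<bar>"
    if "\<And>x. (T has_real_derivative D x) (at x)" "\<And>x. 0 < D x" "\<And>x. D x \<le> 1" for T D :: "real \<Rightarrow> real" and x
  proof -
    have "norm (T x - T 0) \<le> 1 * norm (x - 0)"
      by (rule field_differentiable_bound[of UNIV]) (use that in \<open>auto simp: abs_of_pos\<close>)
    then show ?thesis by auto
  qed
  have Dp: "D x > 0" "D x \<le> 1" for x
    unfolding D_def using convex_bound_lt[of "- D0 x" 0 "- D1 x" "1 - s" s] convex_bound_le[of "D0 x" 1 "D1 x" "1 - s" s]
      T0(2,3)[of x] T1(2,3)[of x] s by auto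
  have Bb: "\<bar>B x\<bar> \<le> (a * \<bar>T0 0\<bar> + b * \<bar>T1 0\<bar> + \<bar>T 0\<bar>) + (2 * a + 2 * b + 2) * \<bar>x\<bar>" for x
  proof -
    have "\<bar>B x\<bar> \<le> a * \<bar>T0 x - x\<bar> + b * \<bar>T1 x - x\<bar> + \<bar>T x - x\<bar>"
    proof -
      have "\<bar>a * (T0 x - x)\<bar> = a * \<bar>T0 x - x\<bar>" "\<bar>b * (T1 x - x)\<bar> = b * \<bar>T1 x - x\<bar>"
        using ab by (simp_all add: abs_mult)
      then show ?thesis unfolding B_def by linarith
    qed
    also have "\<dots> \<le> a * (\<bar>T0 0\<bar> + 2 * \<bar>x\<bar>) + b * (\<bar>T1 0\<bar> + 2 * \<bar>x\<bar>) + (\<bar>T 0\<bar> + 2 * \<bar>x\<bar>)"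
      by (intro add_mono mult_left_mono ab bound[OF T0(1,2,3)] bound[OF T1(1,2,3)] bound[OF dT Dp])
    finally show ?thesis by (simp add: algebra_simps)
  qed
  note Blim = linear_growth_mult_std_normal_tendsto_0[OF Bb]
  have "((\<lambda>N. exp C * ((K N - B N * std_normal_density N) - (K (- N) - B (- N) * std_normal_density (- N))))
      \<longlongrightarrow> exp C * ((1 - 0) - (0 - 0))) at_top"
    by (intro tendsto_intros K Blim filterlim_compose[OF K(2) filterlim_uminus_at_bot_at_top])
  moreover have "\<forall>\<^sub>F N in at_top. exp C * ((K N - B N * std_normal_density N) - (K (- N) - B (- N) * std_normal_density (- N))) \<le> Z m F"
    using eventually_ge_at_top[of 0]
  proof eventually_elim
    case (elim N)
    then have "L (- N) \<le> L N" by (intro Lmono) auto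
    then show ?case using Hp(2)[of "T (- N)"] Hp(3)[of "T N"] unfolding L_def by (simp add: right_diff_distrib)
  qed
  ultimately have "exp C * ((1 - 0) - (0 - 0)) \<le> Z m F" by (rule tendsto_upperbound) simp
  then have "ln (Z m F) \<ge> C" using ln_mono[of "exp C" "Z m F"] Zpos[OF mpos conv(3)] by simp
  then have "- ln (Z m F) / m \<le> - C / m" using mpos by (simp add: divide_right_mono)
  also have "- C / m = (1 - s) * (- ln (Z m0 F0) / m0) + s * (- ln (Z m1 F1) / m1)"
    unfolding C_def a_def b_def using mpos m by (simp add: field_simps)
  finally show ?thesis
    unfolding free_energy_def m_def[symmetric] Z_def w_def .
qed

section \<open>Induction on the coordinates\<close>

text \<open>\<open>F\<close> may depend on the parameter because integrating out a coordinate
  creates such a dependence. Points are functions on the whole index type, so any coordinate can be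
  overwritten.\<close>

definition jointly_convex :: "(real \<Rightarrow> ('i \<Rightarrow> real) \<Rightarrow> real) \<Rightarrow> bool" where
  "jointly_convex F \<longleftrightarrow> (\<forall>m0>0. \<forall>m1>0. \<forall>s\<ge>0. s \<le> 1 \<longrightarrow> (\<forall>x y.
     F ((1 - s) * m0 + s * m1) (\<lambda>i. (1 - s) * x i + s * y i) \<le> (1 - s) * F m0 x + s * F m1 y))"

lemma jointly_convexD:
  "jointly_convex F \<Longrightarrow> m0 > 0 \<Longrightarrow> m1 > 0 \<Longrightarrow> 0 \<le> s \<Longrightarrow> s \<le> 1 \<Longrightarrow>
    F ((1 - s) * m0 + s * m1) (\<lambda>i. (1 - s) * x i + s * y i) \<le> (1 - s) * F m0 x + s * F m1 y"
  unfolding jointly_convex_def by blast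

lemma fun_upd_convex_combination:
  fixes x x' :: "'i \<Rightarrow> real"
  shows "(\<lambda>j. (1 - s) * (x(i := y)) j + s * (x'(i := z)) j) =
    (\<lambda>j. (1 - s) * x j + s * x' j)(i := (1 - s) * y + s * z)"
  by (auto simp: fun_eq_iff)

lemma convex_on_section:
  fixes F :: "real \<Rightarrow> ('i \<Rightarrow> real) \<Rightarrow> real"
  assumes F: "jointly_convex F" and m: "m > 0"
  shows "convex_on UNIV (\<lambda>y. F m (x(i := y)))"
proof (rule convex_onI)
  fix t y z :: real assume t: "0 < t" "t < 1"
  have e: "(1 - t) * m + t * m = m" "(\<lambda>j. (1 - t) * x j + t * x j) = x" by (auto simp: algebra_simps)
  from jointly_convexD[OF F m m, of t "x(i := y)" "x(i := z)"] t
  show "F m (x(i := (1 - t) *\<^sub>R y + t *\<^sub>R z)) \<le> (1 - t) * F m (x(i := y)) + t * F m (x(i := z))"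
    unfolding fun_upd_convex_combination e by simp
qed simp

text \<open>The three-function inequality is applied to the sections along coordinate
  \<open>i\<close> at \<open>x\<close>, at \<open>x'\<close> and at their interpolation.\<close>

lemma jointly_convex_free_energy:
  assumes F: "jointly_convex F"
  shows "jointly_convex (\<lambda>m x. free_energy m (\<lambda>y. F m (x(i := y))))"
  unfolding jointly_convex_def
proof (intro allI impI)
  fix m0 m1 s :: real and x x' :: "'a \<Rightarrow> real"
  assume m: "m0 > 0" "m1 > 0" and s: "0 \<le> s" "s \<le> 1"
  have "(1 - s) * m0 + s * m1 > 0"
    using convex_bound_lt[of "- m0" 0 "- m1" "1 - s" s] m s by simp
  then show "free_energy ((1 - s) * m0 + s * m1)
      (\<lambda>y. F ((1 - s) * m0 + s * m1) ((\<lambda>i. (1 - s) * x i + s * x' i)(i := y)))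
    \<le> (1 - s) * free_energy m0 (\<lambda>y. F m0 (x(i := y))) + s * free_energy m1 (\<lambda>y. F m1 (x'(i := y)))"
    using jointly_convexD[OF F m s, of "x(i := _)" "x'(i := _)"]
    unfolding fun_upd_convex_combination
    by (intro free_energy_three_functions convex_on_section F m s)
qed

abbreviation std_gaussian :: "real measure" where
  "std_gaussian \<equiv> density lborel std_normal_density"

text \<open>The nonnegative integral lets Tonelli iterate this over the coordinates without
  integrability conditions.\<close>

lemma nn_integral_exp_std_gaussian:
  fixes f :: "real \<Rightarrow> real"
  assumes f: "convex_on UNIV f" and m: "m > 0"
  shows "(\<integral>\<^sup>+y. exp (- (m * f y)) \<partial>std_gaussian) = exp (- (m * free_energy m f))"
proof -
  have mf: "convex_on UNIV (\<lambda>y. m * f y)" using f m by (intro convex_on_cmul) auto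
  have [measurable]: "f \<in> borel_measurable borel"
    using f by (intro borel_measurable_continuous_onI convex_on_continuous) auto
  have "(\<integral>\<^sup>+y. exp (- (m * f y)) \<partial>std_gaussian)
      = (\<integral>\<^sup>+y. ennreal (exp (- (m * f y)) * std_normal_density y) \<partial>lborel)"
    by (simp add: nn_integral_density ennreal_mult[symmetric] mult.commute)
  also have "\<dots> = ennreal (\<integral>y. exp (- (m * f y)) * std_normal_density y \<partial>lborel)"
    by (intro nn_integral_eq_integral integrable_exp_convex_std_normal[OF mf]) auto
  also have "\<dots> = exp (- (m * free_energy m f))"
    using m std_normal_partition_pos[OF mf] by (simp add: free_energy_def)
  finally show ?thesis .
qed

text \<open>Integrating out coordinate \<open>i\<close> turns \<open>F\<close> into its free energy
  \<open>G\<close>, again jointly convex, so the induction hypothesis is applied to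
  \<open>G\<close>; this is why \<open>F\<close> is kept arbitrary.\<close>

proposition gaussian_product_free_energy:
  fixes F :: "real \<Rightarrow> ('i \<Rightarrow> real) \<Rightarrow> real"
  assumes "finite I" "jointly_convex F"
    and "\<And>m. m > 0 \<Longrightarrow> F m \<in> borel_measurable (\<Pi>\<^sub>M i\<in>I. std_gaussian)"
  shows "\<exists>\<Psi>. convex_on {0<..} \<Psi> \<and>
    (\<forall>m>0. (\<integral>\<^sup>+x. exp (- (m * F m x)) \<partial>(\<Pi>\<^sub>M i\<in>I. std_gaussian)) = exp (- (m * \<Psi> m)))"
  using assms
proof (induction I arbitrary: F rule: finite_induct)
  case empty
  interpret product_sigma_finite "\<lambda>_. std_gaussian"
    unfolding product_sigma_finite_def
    using prob_space_normal_density[of 1 0] by (simp add: prob_space_imp_sigma_finite)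
  \<comment> \<open>The empty product is the point mass at the everywhere \<open>undefined\<close>
    function, and convex combinations fix this point.\<close>
  have "convex_on {0<..} (\<lambda>m. F m (\<lambda>_. undefined))"
  proof (rule convex_onI)
    fix t x y :: real assume t: "0 < t" "t < 1" and xy: "x \<in> {0<..}" "y \<in> {0<..}"
    have e: "(\<lambda>j. (1 - t) * undefined + t * undefined) = (\<lambda>_. undefined :: real)" by (auto simp: algebra_simps)
    from jointly_convexD[OF empty(1), of x y t "\<lambda>_. undefined" "\<lambda>_. undefined"] t xy
    show "F ((1 - t) *\<^sub>R x + t *\<^sub>R y) (\<lambda>_. undefined) \<le> (1 - t) * F x (\<lambda>_. undefined) + t * F y (\<lambda>_. undefined)"
      unfolding e by simp
  qed simp
  then show ?case by (intro exI[of _ "\<lambda>m. F m (\<lambda>_. undefined)"]) (simp add: nn_integral_empty)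
next
  case (insert i I)
  interpret product_sigma_finite "\<lambda>_. std_gaussian"
    unfolding product_sigma_finite_def
    using prob_space_normal_density[of 1 0] by (simp add: prob_space_imp_sigma_finite)
  define G where "G = (\<lambda>m x. free_energy m (\<lambda>y. F m (x(i := y))))"
  have "G m \<in> borel_measurable (\<Pi>\<^sub>M i\<in>I. std_gaussian)" if m: "m > 0" for m
  proof -
    note insert.prems(2)[OF m, measurable]
    have [measurable]: "(\<lambda>(x, y). x(i := y)) \<in> (\<Pi>\<^sub>M i\<in>I. std_gaussian) \<Otimes>\<^sub>M lborel \<rightarrow>\<^sub>M (\<Pi>\<^sub>M i\<in>insert i I. std_gaussian)"
      using measurable_add_dim[of i I "\<lambda>_. std_gaussian"]
      by (simp cong: measurable_cong_sets sets_pair_measure_cong)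
    show ?thesis
      unfolding G_def free_energy_def by measurable
  qed
  moreover have "jointly_convex G"
    unfolding G_def by (rule jointly_convex_free_energy[OF insert.prems(1)])
  ultimately obtain \<Psi> where \<Psi>: "convex_on {0<..} \<Psi>"
    "\<And>m. m > 0 \<Longrightarrow> (\<integral>\<^sup>+x. exp (- (m * G m x)) \<partial>(\<Pi>\<^sub>M i\<in>I. std_gaussian)) = exp (- (m * \<Psi> m))"
    using insert.IH[of G] by blast
  have "(\<integral>\<^sup>+x. exp (- (m * F m x)) \<partial>(\<Pi>\<^sub>M i\<in>insert i I. std_gaussian)) = exp (- (m * \<Psi> m))" if m: "m > 0" for m
  proof -
    note insert.prems(2)[OF m, measurable]
    have "(\<integral>\<^sup>+x. exp (- (m * F m x)) \<partial>(\<Pi>\<^sub>M i\<in>insert i I. std_gaussian))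
      = (\<integral>\<^sup>+x. \<integral>\<^sup>+y. exp (- (m * F m (x(i := y)))) \<partial>std_gaussian \<partial>(\<Pi>\<^sub>M i\<in>I. std_gaussian))"
      by (rule product_nn_integral_insert) (use insert.hyps in auto)
    also have "\<dots> = (\<integral>\<^sup>+x. exp (- (m * G m x)) \<partial>(\<Pi>\<^sub>M i\<in>I. std_gaussian))"
      unfolding G_def by (intro nn_integral_cong nn_integral_exp_std_gaussian convex_on_section insert.prems m)
    finally show ?thesis using \<Psi>(2)[OF m] by simp
  qed
  with \<Psi>(1) show ?case by blast
qed

section \<open>Transfer to standard Gaussian vectors\<close>

lemma standard_gaussian_vector_distr:
  fixes g :: "'w \<Rightarrow> real ^ 'n"
  assumes M: "prob_space M" and g: "standard_gaussian_vector M g"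
  shows "distr M (\<Pi>\<^sub>M i\<in>UNIV. borel) (\<lambda>\<omega> i. g \<omega> $ i) = (\<Pi>\<^sub>M i\<in>UNIV. std_gaussian)"
    and "\<And>i. (\<lambda>\<omega>. g \<omega> $ i) \<in> borel_measurable M"
proof -
  interpret prob_space M by (rule M)
  have d: "distributed M lborel (\<lambda>\<omega>. g \<omega> $ i) std_normal_density" for i
    using g by (simp add: standard_gaussian_vector_def)
  show rv: "(\<lambda>\<omega>. g \<omega> $ i) \<in> borel_measurable M" for i
    using distributed_measurable[OF d[of i]] by simp
  have "distr M borel (\<lambda>\<omega>. g \<omega> $ i) = std_gaussian" for i
    using distributed_distr_eq_density[OF d[of i]] by (simp cong: distr_cong)
  moreover have "distr M (\<Pi>\<^sub>M i\<in>UNIV. borel) (\<lambda>\<omega>. \<lambda>i\<in>UNIV. g \<omega> $ i) = (\<Pi>\<^sub>M i\<in>UNIV. distr M borel (\<lambda>\<omega>. g \<omega> $ i))"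
    using g rv by (subst indep_vars_iff_distr_eq_PiM[symmetric]) (auto simp: standard_gaussian_vector_def)
  ultimately show "distr M (\<Pi>\<^sub>M i\<in>UNIV. borel) (\<lambda>\<omega> i. g \<omega> $ i) = (\<Pi>\<^sub>M i\<in>UNIV. std_gaussian)"
    by (simp add: restrict_def)
qed

lemma measurable_vec_lambda:
  "(\<lambda>x. \<chi> i. x i) \<in> (\<Pi>\<^sub>M i\<in>(UNIV :: 'n::finite set). borel) \<rightarrow>\<^sub>M (borel :: (real ^ 'n) measure)"
proof (subst borel_measurable_euclidean_space, rule ballI)
  fix b :: "real ^ 'n" assume "b \<in> Basis"
  then obtain j where "b = axis j 1" by (auto simp: Basis_vec_def)
  then show "(\<lambda>x. (\<chi> i. x i) \<bullet> b) \<in> borel_measurable (\<Pi>\<^sub>M i\<in>UNIV. borel)"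
    by (simp add: inner_axis)
qed

text \<open>Read as a function of the coordinates and constant in \<open>m\<close>, \<open>F\<close>
  is jointly convex, so the product result applies to the law of \<open>g\<close>. Finiteness of the
  nonnegative integral also gives integrability.\<close>

theorem gaussian_free_energy_convex:
  fixes g :: "'w \<Rightarrow> real ^ 'n" and F :: "real ^ 'n \<Rightarrow> real"
  assumes M: "prob_space M" and g: "standard_gaussian_vector M g" and F: "convex_on UNIV F"
  shows "(\<lambda>\<omega>. F (g \<omega>)) \<in> borel_measurable M"
    and "m > 0 \<Longrightarrow> integrable M (\<lambda>\<omega>. exp (- (m * F (g \<omega>))))"
    and "convex_on {0<..} (\<lambda>m. - ln (\<integral>\<omega>. exp (- (m * F (g \<omega>))) \<partial>M) / m)"
proof -
  interpret prob_space M by (rule M)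
  define F' where "F' = (\<lambda>(m::real) x. F (\<chi> i. x i))"
  have [measurable]: "F \<in> borel_measurable borel"
    using F by (intro borel_measurable_continuous_onI convex_on_continuous) auto
  note measurable_vec_lambda[measurable] standard_gaussian_vector_distr(2)[OF M g, measurable]
  have gm: "(\<lambda>\<omega> i. g \<omega> $ i) \<in> M \<rightarrow>\<^sub>M (\<Pi>\<^sub>M i\<in>UNIV. borel)"
    by (rule measurable_PiM_single') (auto simp: PiE_def)
  have F'm: "F' m \<in> borel_measurable (\<Pi>\<^sub>M i\<in>UNIV. borel)" for m
    unfolding F'_def by measurable
  have F'g: "F' m (\<lambda>i. g \<omega> $ i) = F (g \<omega>)" for m \<omega> unfolding F'_def by simp
  show meas [measurable]: "(\<lambda>\<omega>. F (g \<omega>)) \<in> borel_measurable M"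
    using measurable_compose[OF gm F'm] unfolding F'g .
  have "jointly_convex F'"
    unfolding jointly_convex_def
  proof (intro allI impI)
    fix m0 m1 s :: real and x y :: "'n \<Rightarrow> real" assume "0 \<le> s" "s \<le> 1"
    then have "F ((1 - s) *\<^sub>R (\<chi> i. x i) + s *\<^sub>R (\<chi> i. y i)) \<le> (1 - s) * F (\<chi> i. x i) + s * F (\<chi> i. y i)"
      by (intro convex_onD[OF F]) auto
    moreover have "(1 - s) *\<^sub>R (\<chi> i. x i) + s *\<^sub>R (\<chi> i. y i) = (\<chi> i. (1 - s) * x i + s * y i)"
      by (simp add: vec_eq_iff)
    ultimately show "F' ((1 - s) * m0 + s * m1) (\<lambda>i. (1 - s) * x i + s * y i) \<le> (1 - s) * F' m0 x + s * F' m1 y"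
      unfolding F'_def by simp
  qed
  moreover have "F' m \<in> borel_measurable (\<Pi>\<^sub>M i\<in>UNIV. std_gaussian)" for m
    using F'm unfolding standard_gaussian_vector_distr(1)[OF M g, symmetric] by simp
  ultimately obtain \<Psi> where \<Psi>: "convex_on {0<..} \<Psi>"
    "\<And>m. m > 0 \<Longrightarrow> (\<integral>\<^sup>+x. exp (- (m * F' m x)) \<partial>(\<Pi>\<^sub>M i\<in>UNIV. std_gaussian)) = exp (- (m * \<Psi> m))"
    using gaussian_product_free_energy[of UNIV F'] by auto
  have nn: "(\<integral>\<^sup>+\<omega>. exp (- (m * F (g \<omega>))) \<partial>M) = exp (- (m * \<Psi> m))" if "m > 0" for m
    using \<Psi>(2)[OF that] gm F'm unfolding standard_gaussian_vector_distr(1)[OF M g, symmetric]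
    by (subst (asm) nn_integral_distr) (auto simp: F'g)
  show int: "integrable M (\<lambda>\<omega>. exp (- (m * F (g \<omega>))))" if "m > 0" for m
    using nn[OF that] by (intro integrableI_nonneg) auto
  have "(\<integral>\<omega>. exp (- (m * F (g \<omega>))) \<partial>M) = exp (- (m * \<Psi> m))" if "m > 0" for m
    using nn[OF that] by (subst integral_eq_nn_integral) auto
  then have "- ln (\<integral>\<omega>. exp (- (m * F (g \<omega>))) \<partial>M) / m = \<Psi> m" if "m > 0" for m
    using that by simp
  moreover have "(1 - t) * x + t * y > 0" if "0 < t" "t < 1" "x > 0" "y > 0" for t x y :: real
    using that by (intro add_pos_pos) auto
  ultimately show "convex_on {0<..} (\<lambda>m. - ln (\<integral>\<omega>. exp (- (m * F (g \<omega>))) \<partial>M) / m)"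
    using convex_onD[OF \<Psi>(1)] by (intro convex_onI) auto
qed

section \<open>Consequences of convexity of the free energy\<close>

text \<open>The factor 1/2, with \<open>max 1 (exp z)\<close> tending to 1 at 0, is what produces
  half the variance in the limit. For \<open>z \<ge> 0\<close> this is the Lagrange remainder; for
  \<open>z < 0\<close> the quadratic Taylor polynomial dominates \<open>exp\<close>.\<close>

lemma exp_minus_affine_le: "exp z - 1 - z \<le> z\<^sup>2 / 2 * max 1 (exp z)" for z :: real
proof (cases "z \<ge> 0")
  case True
  obtain t where t: "\<bar>t\<bar> \<le> \<bar>z\<bar>" "exp z = (\<Sum>m<2. z ^ m / fact m) + exp t / fact 2 * z ^ 2"
    using Maclaurin_exp_le[of z 2] by blast
  have "t \<le> z" using t(1) True by simp
  then have "exp t \<le> max 1 (exp z)" by (intro max.coboundedI2) simp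
  then have "exp t * (z\<^sup>2 / 2) \<le> max 1 (exp z) * (z\<^sup>2 / 2)" by (intro mult_right_mono) auto
  moreover have "exp z = 1 + z + exp t * (z\<^sup>2 / 2)"
    using t(2) by (simp add: lessThan_nat_numeral)
  ultimately show ?thesis by (simp add: mult.commute)
next
  case False
  let ?h = "\<lambda>z::real. 1 + z + z\<^sup>2 / 2 - exp z"
  have "z \<le> 0" using False by simp
  then have "?h z \<ge> ?h 0"
  proof (rule DERIV_nonpos_imp_nonincreasing)
    fix x :: real
    have "(?h has_real_derivative 1 + x - exp x) (at x)" by (auto intro!: derivative_eq_intros)
    then show "\<exists>y. (?h has_real_derivative y) (at x) \<and> y \<le> 0"
      using exp_ge_add_one_self[of x] by (intro exI[of _ "1 + x - exp x"]) simp
  qed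
  moreover have "z\<^sup>2 / 2 * 1 \<le> z\<^sup>2 / 2 * max 1 (exp z)" by (intro mult_left_mono) auto
  ultimately show ?thesis by simp
qed

lemma abs_exp_minus_affine_le: "\<bar>exp z - 1 - z\<bar> \<le> z\<^sup>2 * exp \<bar>z\<bar>" for z :: real
proof -
  have "max 1 (exp z) \<le> exp \<bar>z\<bar>" by simp
  then have "z\<^sup>2 / 2 * max 1 (exp z) \<le> z\<^sup>2 * exp \<bar>z\<bar>"
    by (intro mult_mono) auto
  moreover have "exp z - 1 - z \<ge> 0" using exp_ge_add_one_self[of z] by linarith
  ultimately show ?thesis using exp_minus_affine_le[of z] by linarith
qed

lemma square_le_exp: "z\<^sup>2 \<le> 2 * exp \<bar>z\<bar>" for z :: real
  using exp_lower_Taylor_quadratic[of "\<bar>z\<bar>"] by simp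

section \<open>The Laplace transform and its derivative\<close>

text \<open>Collects the properties of \<open>F (g \<omega>)\<close> from which the three claims are
  derived.\<close>

locale convex_free_energy = prob_space M for M :: "'w measure" +
  fixes X :: "'w \<Rightarrow> real"
  assumes meas [measurable]: "X \<in> borel_measurable M"
    and square_int: "integrable M (\<lambda>\<omega>. (X \<omega>)\<^sup>2)"
    and exp_int: "\<And>m. m > 0 \<Longrightarrow> integrable M (\<lambda>\<omega>. exp (- (m * X \<omega>)))"
    and convex: "convex_on {0<..} (\<lambda>m. - ln (\<integral>\<omega>. exp (- (m * X \<omega>)) \<partial>M) / m)"
begin

text \<open>\<open>A\<close> is the Laplace transform of \<open>X\<close>, \<open>A'\<close> comes
  from differentiating under the expectation, and for \<open>m > 0\<close> the value
  \<open>\<Psi> m\<close> is \<open>Phi M X (- m)\<close>.\<close>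

definition A :: "real \<Rightarrow> real" where "A m = expectation (\<lambda>\<omega>. exp (- (m * X \<omega>)))"
definition A' :: "real \<Rightarrow> real" where "A' m = expectation (\<lambda>\<omega>. - X \<omega> * exp (- (m * X \<omega>)))"
definition \<Psi> :: "real \<Rightarrow> real" where "\<Psi> m = - ln (A m) / m"

lemma convex_\<Psi>: "convex_on {0<..} \<Psi>"
  using convex unfolding \<Psi>_def A_def .

lemma X_int: "integrable M X"
  using square_integrable_imp_integrable[OF meas square_int] .

lemma A_pos: "m > 0 \<Longrightarrow> A m > 0"
  unfolding A_def by (rule expectation_greater) (auto simp: exp_int)

text \<open>Dominates the second-order remainder of \<open>exp (- ((m + h) * X \<omega>))\<close> in
  \<open>h\<close> for \<open>\<bar>h\<bar> < m / 2\<close>; hence the extra exponent.\<close>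

lemma square_exp_int:
  assumes m: "m > 0"
  shows "integrable M (\<lambda>\<omega>. (X \<omega>)\<^sup>2 * exp (- (m * X \<omega>) + m / 2 * \<bar>X \<omega>\<bar>))"
proof (rule Bochner_Integration.integrable_bound)
  \<comment> \<open>\<open>square_le_exp\<close> at \<open>m / 4 * X \<omega>\<close> gives the
    constant \<open>32 / m^2\<close>. The resulting exponent has coefficient \<open>- m / 4\<close>
    or \<open>- 7 * m / 4\<close>, according to the sign of \<open>X \<omega>\<close>.\<close>
  let ?w = "\<lambda>\<omega>. 32 / m\<^sup>2 * (exp (- (m / 4 * X \<omega>)) + exp (- (7 * m / 4 * X \<omega>)))"
  show "integrable M ?w" using m by (intro integrable_mult_right Bochner_Integration.integrable_add exp_int) auto
  show "AE \<omega> in M. norm ((X \<omega>)\<^sup>2 * exp (- (m * X \<omega>) + m / 2 * \<bar>X \<omega>\<bar>)) \<le> norm (?w \<omega>)"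
  proof (rule AE_I2)
    fix \<omega>
    let ?x = "X \<omega>"
    have "m\<^sup>2 / 16 * ?x\<^sup>2 \<le> 2 * exp (m / 4 * \<bar>?x\<bar>)"
      using square_le_exp[of "m / 4 * ?x"] m by (simp add: power_mult_distrib power_divide abs_mult)
    then have "?x\<^sup>2 \<le> 32 / m\<^sup>2 * exp (m / 4 * \<bar>?x\<bar>)" using m by (simp add: field_simps)
    then have "?x\<^sup>2 * exp (- (m * ?x) + m / 2 * \<bar>?x\<bar>)
        \<le> 32 / m\<^sup>2 * exp (m / 4 * \<bar>?x\<bar>) * exp (- (m * ?x) + m / 2 * \<bar>?x\<bar>)"
      by (intro mult_right_mono) auto
    also have "\<dots> = 32 / m\<^sup>2 * exp (- (m * ?x) + 3 * m / 4 * \<bar>?x\<bar>)"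
      by (simp add: exp_add[symmetric] algebra_simps)
    also have "\<dots> \<le> ?w \<omega>"
    proof (intro mult_left_mono)
      have "- (m * ?x) + 3 * m / 4 * \<bar>?x\<bar> = - (m / 4 * ?x) \<or> - (m * ?x) + 3 * m / 4 * \<bar>?x\<bar> = - (7 * m / 4 * ?x)"
        by (auto simp: abs_if)
      then show "exp (- (m * ?x) + 3 * m / 4 * \<bar>?x\<bar>) \<le> exp (- (m / 4 * ?x)) + exp (- (7 * m / 4 * ?x))"
        by (elim disjE) simp_all
    qed simp
    finally show "norm (?x\<^sup>2 * exp (- (m * ?x) + m / 2 * \<bar>?x\<bar>)) \<le> norm (?w \<omega>)" by simp
  qed
qed measurable

lemma X_exp_int:
  assumes m: "m > 0"
  shows "integrable M (\<lambda>\<omega>. - X \<omega> * exp (- (m * X \<omega>)))"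
proof (rule Bochner_Integration.integrable_bound)
  let ?w = "\<lambda>\<omega>. exp (- (m * X \<omega>)) + (X \<omega>)\<^sup>2 * exp (- (m * X \<omega>) + m / 2 * \<bar>X \<omega>\<bar>)"
  show "integrable M ?w" using m by (intro Bochner_Integration.integrable_add exp_int square_exp_int) auto
  show "AE \<omega> in M. norm (- X \<omega> * exp (- (m * X \<omega>))) \<le> norm (?w \<omega>)"
  proof (rule AE_I2)
    fix \<omega>
    let ?x = "X \<omega>"
    have "\<bar>?x\<bar> \<le> 1 + ?x\<^sup>2"
      using zero_le_power2[of "\<bar>?x\<bar> - 1"] zero_le_power2[of ?x]
      by (simp add: power2_diff)
    then have "\<bar>?x\<bar> * exp (- (m * ?x)) \<le> (1 + ?x\<^sup>2) * exp (- (m * ?x))" by (intro mult_right_mono) auto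
    also have "\<dots> \<le> ?w \<omega>" using m by (simp add: distrib_right) (auto intro!: mult_left_mono)
    finally show "norm (- ?x * exp (- (m * ?x))) \<le> norm (?w \<omega>)" by (simp add: abs_mult)
  qed
qed measurable

text \<open>Integrating the quadratic remainder bound for \<open>exp\<close> shows that the
  difference quotient is off by at most \<open>K * \<bar>h\<bar>\<close>.\<close>

lemma A_deriv:
  assumes m: "m > 0"
  shows "(A has_real_derivative A' m) (at m)"
proof -
  define K where "K = expectation (\<lambda>\<omega>. (X \<omega>)\<^sup>2 * exp (- (m * X \<omega>) + m / 2 * \<bar>X \<omega>\<bar>))"
  have bound: "\<bar>(A (m + h) - A m) / h - A' m\<bar> \<le> K * \<bar>h\<bar>" if h: "h \<noteq> 0" "\<bar>h\<bar> < m / 2" for h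
  proof -
    have mh: "m + h > 0" using h m by linarith
    let ?r = "\<lambda>\<omega>. exp (- ((m + h) * X \<omega>)) - exp (- (m * X \<omega>)) - h * (- X \<omega> * exp (- (m * X \<omega>)))"
    have r: "A (m + h) - A m - h * A' m = expectation ?r"
      unfolding A_def A'_def using exp_int[OF mh] exp_int[OF m] X_exp_int[OF m] by simp
    have rint: "integrable M ?r"
      by (intro Bochner_Integration.integrable_diff integrable_mult_right exp_int X_exp_int m mh)
    have "\<bar>expectation ?r\<bar> \<le> expectation (\<lambda>\<omega>. \<bar>?r \<omega>\<bar>)" by (rule integral_abs_bound)
    also have "\<dots> \<le> expectation (\<lambda>\<omega>. h\<^sup>2 * ((X \<omega>)\<^sup>2 * exp (- (m * X \<omega>) + m / 2 * \<bar>X \<omega>\<bar>)))"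
    proof (rule integral_mono)
      fix \<omega>
      let ?x = "X \<omega>"
      have "?r \<omega> = exp (- (m * ?x)) * (exp (- h * ?x) - 1 - (- h * ?x))"
        by (simp add: algebra_simps flip: exp_add)
      then have "\<bar>?r \<omega>\<bar> = exp (- (m * ?x)) * \<bar>exp (- h * ?x) - 1 - (- h * ?x)\<bar>" by (simp add: abs_mult)
      also have "\<dots> \<le> exp (- (m * ?x)) * ((- h * ?x)\<^sup>2 * exp \<bar>- h * ?x\<bar>)"
        by (intro mult_left_mono abs_exp_minus_affine_le) auto
      also have "\<dots> \<le> exp (- (m * ?x)) * ((- h * ?x)\<^sup>2 * exp (m / 2 * \<bar>?x\<bar>))"
      proof -
        have "\<bar>h\<bar> * \<bar>?x\<bar> \<le> m / 2 * \<bar>?x\<bar>" using h by (intro mult_right_mono) auto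
        then show ?thesis by (intro mult_left_mono) (auto simp: abs_mult)
      qed
      also have "\<dots> = h\<^sup>2 * (?x\<^sup>2 * exp (- (m * ?x) + m / 2 * \<bar>?x\<bar>))"
        unfolding exp_add power_mult_distrib by simp
      finally show "\<bar>?r \<omega>\<bar> \<le> h\<^sup>2 * (?x\<^sup>2 * exp (- (m * ?x) + m / 2 * \<bar>?x\<bar>))" .
    qed (use rint square_exp_int[OF m] in auto)
    also have "\<dots> = K * \<bar>h\<bar> * \<bar>h\<bar>" unfolding K_def by (simp add: power2_eq_square)
    finally have "\<bar>A (m + h) - A m - h * A' m\<bar> / \<bar>h\<bar> \<le> K * \<bar>h\<bar>"
      unfolding r using h by (simp add: divide_le_eq)
    also have "\<bar>A (m + h) - A m - h * A' m\<bar> / \<bar>h\<bar> = \<bar>(A (m + h) - A m) / h - A' m\<bar>"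
      using h by (simp add: abs_divide[symmetric] diff_divide_distrib)
    finally show ?thesis .
  qed
  have "((\<lambda>h. (A (m + h) - A m) / h - A' m) \<longlongrightarrow> 0) (at 0)"
  proof (rule Lim_null_comparison)
    show "\<forall>\<^sub>F h in at 0. norm ((A (m + h) - A m) / h - A' m) \<le> K * \<bar>h\<bar>"
      unfolding eventually_at using bound m by (intro exI[of _ "m / 2"]) auto
    show "((\<lambda>h. K * \<bar>h\<bar>) \<longlongrightarrow> 0) (at 0)" by (auto intro!: tendsto_eq_intros)
  qed
  then show ?thesis unfolding DERIV_def by (simp add: LIM_zero_iff)
qed

text \<open>Convexity of \<open>ln A\<close> in tangent form: Jensen's inequality under the measure
  tilted by \<open>exp (- (m' * X \<omega>))\<close>.\<close>

lemma ln_A_tangent: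
  assumes m: "m > 0" "m' > 0"
  shows "ln (A m') + A' m' / A m' * (m - m') \<le> ln (A m)"
proof -
  \<comment> \<open>\<open>c\<close> is the mean of \<open>X\<close> under the tilted measure; this
    choice annuls the linear term when \<open>1 + (m - m') * (c - X \<omega>)\<close> is
    integrated.\<close>
  define c where "c = - A' m' / A m'"
  have Ap: "A m > 0" "A m' > 0" using m A_pos by auto
  have "exp (- ((m - m') * c)) * (A m' + (m - m') * (c * A m' + A' m'))
    = expectation (\<lambda>\<omega>. exp (- ((m - m') * c)) * (exp (- (m' * X \<omega>)) + (m - m') * (c * exp (- (m' * X \<omega>)) + - X \<omega> * exp (- (m' * X \<omega>)))))"
    unfolding A_def A'_def using exp_int[OF m(2)] X_exp_int[OF m(2)] by simp
  also have "\<dots> \<le> A m"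
    unfolding A_def
  proof (rule integral_mono)
    fix \<omega>
    have "exp (- ((m - m') * c)) * exp (- (m' * X \<omega>)) * (1 + (m - m') * (c - X \<omega>))
      \<le> exp (- ((m - m') * c)) * exp (- (m' * X \<omega>)) * exp ((m - m') * (c - X \<omega>))"
      by (intro mult_left_mono exp_ge_add_one_self) auto
    also have "\<dots> = exp (- (m * X \<omega>))" by (simp add: algebra_simps flip: exp_add)
    finally show "exp (- ((m - m') * c)) * (exp (- (m' * X \<omega>)) + (m - m') * (c * exp (- (m' * X \<omega>)) + - X \<omega> * exp (- (m' * X \<omega>))))
      \<le> exp (- (m * X \<omega>))" by (simp add: algebra_simps)
  qed (intro exp_int m integrable_mult_right Bochner_Integration.integrable_add X_exp_int)+
  also have "c * A m' + A' m' = 0" unfolding c_def using Ap by simp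
  finally have "exp (- ((m - m') * c)) * A m' \<le> A m" by simp
  then have "ln (exp (- ((m - m') * c)) * A m') \<le> ln (A m)" using Ap by (intro ln_mono) auto
  then show ?thesis using Ap by (simp add: ln_mult c_def mult.commute)
qed

section \<open>Comparison of the free energy with the mean\<close>

text \<open>Jensen's inequality for the exponential, through its tangent at the mean.\<close>

lemma \<Psi>_le:
  assumes m: "m > 0"
  shows "\<Psi> m \<le> expectation X"
proof -
  have "exp (- (m * expectation X)) * (1 + m * (expectation X - expectation X))
    = expectation (\<lambda>\<omega>. exp (- (m * expectation X)) * (1 + m * (expectation X - X \<omega>)))"
    using X_int by (simp add: prob_space)
  also have "\<dots> \<le> A m"
    unfolding A_def
  proof (rule integral_mono)
    fix \<omega>
    have "exp (- (m * expectation X)) * (1 + m * (expectation X - X \<omega>))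
      \<le> exp (- (m * expectation X)) * exp (m * (expectation X - X \<omega>))"
      by (intro mult_left_mono exp_ge_add_one_self) auto
    also have "\<dots> = exp (- (m * X \<omega>))" by (simp add: algebra_simps flip: exp_add)
    finally show "exp (- (m * expectation X)) * (1 + m * (expectation X - X \<omega>)) \<le> exp (- (m * X \<omega>))" .
  qed (use X_int exp_int[OF m] in auto)
  finally have "ln (exp (- (m * expectation X))) \<le> ln (A m)" using A_pos[OF m] by (intro ln_mono) auto
  then show ?thesis unfolding \<Psi>_def using m by (subst pos_divide_le_eq) (auto simp: mult.commute)
qed

text \<open>Convexity of \<open>\<Psi>\<close> and \<open>\<Psi> \<le> expectation X\<close> near \<open>0\<close> make the quotient
  \<open>(expectation X - \<Psi> m) / m\<close> antitone, so it is bounded by its limit at \<open>0\<close>.\<close>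

lemma \<Psi>_slope_antimono:
  assumes "0 < e" "e < m"
  shows "(expectation X - \<Psi> m) / m \<le> (expectation X - \<Psi> e) / e"
proof -
  let ?E = "expectation X"
  \<comment> \<open>Convexity holds on the open half-line, so \<open>e\<close> is first written as a
    convex combination of some \<open>d > 0\<close> and \<open>m\<close>, and then \<open>d\<close>
    tends to 0.\<close>
  have "((\<lambda>d. (m - e) / (m - d) * ?E + (e - d) / (m - d) * \<Psi> m)
      \<longlongrightarrow> (m - e) / (m - 0) * ?E + (e - 0) / (m - 0) * \<Psi> m) (at_right 0)"
    using assms by (intro tendsto_intros) auto
  moreover have "\<forall>\<^sub>F d in at_right 0. \<Psi> e \<le> (m - e) / (m - d) * ?E + (e - d) / (m - d) * \<Psi> m"
  proof -
    have "\<forall>\<^sub>F d::real in at_right 0. d \<in> {0<..<e}" by (rule eventually_at_right_real) (use assms in simp)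
    then show ?thesis
    proof eventually_elim
      case (elim d)
      define t where "t = (e - d) / (m - d)"
      have t: "0 \<le> t" "t \<le> 1" "1 - t = (m - e) / (m - d)" "(1 - t) * d + t * m = e"
        unfolding t_def using assms elim by (auto simp: divide_simps) (auto simp: algebra_simps)
      have "\<Psi> e \<le> (1 - t) * \<Psi> d + t * \<Psi> m"
        using convex_onD[OF convex_\<Psi>, of t d m] t assms elim by auto
      also have "\<dots> \<le> (1 - t) * ?E + t * \<Psi> m"
        using t \<Psi>_le[of d] elim by (intro add_right_mono mult_left_mono) auto
      finally show ?case unfolding t(3) unfolding t_def .
    qed
  qed
  ultimately have "\<Psi> e \<le> (m - e) / (m - 0) * ?E + (e - 0) / (m - 0) * \<Psi> m"
    by (rule tendsto_lowerbound) simp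
  then have "e * (?E - \<Psi> m) \<le> m * (?E - \<Psi> e)" using assms by (simp add: field_simps)
  then show ?thesis using assms by (simp add: field_simps)
qed

text \<open>By \<open>\<Psi>_slope_antimono\<close> the quotient at \<open>m\<close> is at most that
  at small \<open>e\<close>. The latter is at most \<open>expectation (b e)\<close>, by
  \<open>ln u \<le> u - 1\<close> and \<open>exp_minus_affine_le\<close>, and dominated convergence
  sends this to half the variance.\<close>

lemma \<Psi>_ge:
  assumes m: "m > 0"
  shows "expectation X - \<Psi> m \<le> m / 2 * variance X"
proof -
  let ?E = "expectation X"
  define Y where "Y = (\<lambda>\<omega>. X \<omega> - ?E)"
  have [measurable]: "Y \<in> borel_measurable M" unfolding Y_def by simp
  have Y2: "integrable M (\<lambda>\<omega>. (Y \<omega>)\<^sup>2)"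
    unfolding Y_def power2_diff using square_int X_int by simp
  have Yexp: "integrable M (\<lambda>\<omega>. exp (- (k * Y \<omega>)))" if "k > 0" for k
    using integrable_mult_right[OF exp_int[OF that], of "exp (k * ?E)"]
    unfolding Y_def by (simp add: algebra_simps flip: exp_add)
  \<comment> \<open>\<open>w\<close> adds the bounds for the two signs: where
    \<open>Y \<omega> \<ge> 0\<close> the maximum in \<open>b\<close> is 1, and elsewhere
    \<open>square_le_exp\<close> bounds \<open>b e\<close> by
    \<open>exp (- (2 * Y \<omega>))\<close>.\<close>
  define w where "w = (\<lambda>\<omega>. (Y \<omega>)\<^sup>2 + exp (- (2 * Y \<omega>)))"
  have wint: "integrable M w" unfolding w_def using Y2 Yexp[of 2] by simp
  define b where "b = (\<lambda>e \<omega>. (Y \<omega>)\<^sup>2 / 2 * max 1 (exp (- (e * Y \<omega>))))"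
  have bw: "\<bar>b e \<omega>\<bar> \<le> w \<omega>" if e: "0 < e" "e \<le> 1" for e \<omega>
  proof (cases "Y \<omega> \<ge> 0")
    case True
    then have "max 1 (exp (- (e * Y \<omega>))) = 1" using e by (intro max_absorb1) simp
    then have "b e \<omega> = (Y \<omega>)\<^sup>2 / 2" unfolding b_def by simp
    then have "\<bar>b e \<omega>\<bar> \<le> (Y \<omega>)\<^sup>2" by (simp only:) simp
    then show ?thesis unfolding w_def by (rule add_increasing2[OF exp_ge_zero])
  next
    case False
    then have "e * \<bar>Y \<omega>\<bar> \<le> 1 * \<bar>Y \<omega>\<bar>" using e by (intro mult_right_mono) auto
    then have "max 1 (exp (- (e * Y \<omega>))) \<le> exp \<bar>Y \<omega>\<bar>" using False by simp
    then have "b e \<omega> \<le> (2 * exp \<bar>Y \<omega>\<bar>) / 2 * exp \<bar>Y \<omega>\<bar>"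
      unfolding b_def using square_le_exp[of "Y \<omega>"] by (intro mult_mono divide_right_mono) auto
    also have "\<dots> = exp (- (2 * Y \<omega>))" using False by (simp flip: exp_add)
    finally have "b e \<omega> \<le> exp (- (2 * Y \<omega>))" .
    moreover have "0 \<le> b e \<omega>" by (simp add: b_def)
    ultimately have "\<bar>b e \<omega>\<bar> \<le> exp (- (2 * Y \<omega>))" by simp
    then show ?thesis unfolding w_def by (rule add_increasing[OF zero_le_power2])
  qed
  have bint: "integrable M (b e)" if "0 < e" "e \<le> 1" for e
  proof (rule Bochner_Integration.integrable_bound[OF wint])
    show "AE \<omega> in M. norm (b e \<omega>) \<le> norm (w \<omega>)"
    proof (rule AE_I2)
      show "norm (b e \<omega>) \<le> norm (w \<omega>)" for \<omega>
        unfolding real_norm_def by (rule order_trans[OF bw[OF that] abs_ge_self])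
    qed
  qed (simp add: b_def)
  have up: "(?E - \<Psi> e) / e \<le> expectation (b e)" if e: "0 < e" "e \<le> 1" for e
  proof -
    have "ln (A e) + e * ?E = ln (exp (e * ?E) * A e)" using A_pos[OF e(1)] by (simp add: ln_mult)
    also have "exp (e * ?E) * A e = expectation (\<lambda>\<omega>. exp (- (e * Y \<omega>)))"
      unfolding A_def Y_def integral_mult_right_zero[symmetric] by (simp add: algebra_simps flip: exp_add)
    also have "ln \<dots> \<le> \<dots> - 1"
    proof (rule ln_le_minus_one)
      show "0 < expectation (\<lambda>\<omega>. exp (- (e * Y \<omega>)))"
        by (rule expectation_greater) (auto simp: Yexp e)
    qed
    also have "\<dots> = expectation (\<lambda>\<omega>. exp (- (e * Y \<omega>)) - 1 - (- (e * Y \<omega>)))"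
      using Yexp[OF e(1)] X_int unfolding Y_def by (simp add: prob_space)
    also have "\<dots> \<le> expectation (\<lambda>\<omega>. e\<^sup>2 * b e \<omega>)"
    proof (rule integral_mono)
      show "exp (- (e * Y \<omega>)) - 1 - (- (e * Y \<omega>)) \<le> e\<^sup>2 * b e \<omega>" for \<omega>
        using exp_minus_affine_le[of "- (e * Y \<omega>)"] unfolding b_def by (simp add: power_mult_distrib)
    qed (use Yexp[OF e(1)] X_int bint[OF e] in \<open>auto simp: Y_def\<close>)
    finally have "ln (A e) + e * ?E \<le> e\<^sup>2 * expectation (b e)" by simp
    then show ?thesis unfolding \<Psi>_def using e by (simp add: field_simps power2_eq_square)
  qed
  have "(\<lambda>n. expectation (b (inverse (real (Suc n))))) \<longlonglongrightarrow> expectation (\<lambda>\<omega>. (Y \<omega>)\<^sup>2 / 2)"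
  proof (rule integral_dominated_convergence[OF _ _ wint])
    show "AE \<omega> in M. (\<lambda>n. b (inverse (real (Suc n))) \<omega>) \<longlonglongrightarrow> (Y \<omega>)\<^sup>2 / 2"
    proof (rule AE_I2)
      fix \<omega>
      have "(\<lambda>n. b (inverse (real (Suc n))) \<omega>) \<longlonglongrightarrow> (Y \<omega>)\<^sup>2 / 2 * max 1 (exp (- (0 * Y \<omega>)))"
        unfolding b_def by (intro tendsto_intros LIMSEQ_inverse_real_of_nat) 
      then show "(\<lambda>n. b (inverse (real (Suc n))) \<omega>) \<longlonglongrightarrow> (Y \<omega>)\<^sup>2 / 2" by simp
    qed
    show "AE \<omega> in M. norm (b (inverse (real (Suc n))) \<omega>) \<le> w \<omega>" for n
      using bw[of "inverse (real (Suc n))"] by (auto simp: inverse_le_1_iff)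
  qed (auto simp: b_def)
  moreover have "\<forall>\<^sub>F n in sequentially. (?E - \<Psi> m) / m \<le> expectation (b (inverse (real (Suc n))))"
  proof -
    have "\<forall>\<^sub>F n in sequentially. inverse (real (Suc n)) < m"
      using order_tendstoD(2)[OF LIMSEQ_inverse_real_of_nat m] .
    then show ?thesis
    proof eventually_elim
      case (elim n)
      then show ?case
        using \<Psi>_slope_antimono[of "inverse (real (Suc n))" m] up[of "inverse (real (Suc n))"]
        by (force simp: inverse_le_1_iff)
    qed
  qed
  ultimately have "(?E - \<Psi> m) / m \<le> expectation (\<lambda>\<omega>. (Y \<omega>)\<^sup>2 / 2)"
    by (rule tendsto_lowerbound) simp
  then show ?thesis using m unfolding Y_def by (simp add: field_simps)
qed

section \<open>Derivative of the free energy\<close>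

definition \<Psi>' :: "real \<Rightarrow> real" where "\<Psi>' m = ln (A m) / m\<^sup>2 - A' m / A m / m"

lemma \<Psi>_deriv: "m > 0 \<Longrightarrow> (\<Psi> has_real_derivative \<Psi>' m) (at m)"
  unfolding \<Psi>_def[abs_def] \<Psi>'_def using A_pos[of m]
  by (auto intro!: derivative_eq_intros A_deriv simp: power2_eq_square field_simps)

lemma \<Psi>_tangent:
  assumes "m > 0" "m' > 0"
  shows "\<Psi>' m' * (m - m') \<le> \<Psi> m - \<Psi> m'"
  using convex_on_imp_above_tangent[OF convex_\<Psi>, of m' m "\<Psi>' m'"] \<Psi>_deriv[of m'] assms
  by (simp add: has_field_derivative_at_within interior_open)

lemma \<Psi>'_mono:
  assumes "0 < m" "m \<le> m'"
  shows "\<Psi>' m \<le> \<Psi>' m'"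
proof (cases "m = m'")
  case False
  have "\<Psi>' m * (m' - m) + \<Psi>' m' * (m - m') \<le> 0"
    using \<Psi>_tangent[of m m'] \<Psi>_tangent[of m' m] assms by linarith
  then have "(\<Psi>' m - \<Psi>' m') * (m' - m) \<le> 0" by (simp add: algebra_simps)
  then show ?thesis using assms False by (simp add: mult_le_0_iff)
qed simp

text \<open>Followed down to 0, the tangent at \<open>m\<close> stays below the mean, so
  \<open>- m * \<Psi>' m\<close> is at most \<open>expectation X - \<Psi> m\<close>, to which
  \<open>\<Psi>_ge\<close> applies.\<close>

lemma neg_\<Psi>'_le:
  assumes m: "m > 0"
  shows "- \<Psi>' m \<le> variance X / 2"
proof -
  have "((\<lambda>d. \<Psi> m + \<Psi>' m * (d - m)) \<longlongrightarrow> \<Psi> m + \<Psi>' m * (0 - m)) (at_right 0)"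
    by (intro tendsto_intros)
  moreover have "\<forall>\<^sub>F d in at_right 0. \<Psi> m + \<Psi>' m * (d - m) \<le> expectation X"
  proof -
    have "\<forall>\<^sub>F d::real in at_right 0. d > 0" by (rule eventually_at_right_less)
    then show ?thesis
    proof eventually_elim
      case (elim d)
      then show ?case using \<Psi>_tangent[of d m] \<Psi>_le[of d] m by linarith
    qed
  qed
  ultimately have "\<Psi> m + \<Psi>' m * (0 - m) \<le> expectation X" by (rule tendsto_upperbound) simp
  then have "- \<Psi>' m * m \<le> variance X / 2 * m" using \<Psi>_ge[OF m] by (simp add: mult.commute)
  then show ?thesis using m by (simp only: mult_le_cancel_right_pos)
qed

text \<open>\<open>- m\<^sup>2 * \<Psi>' m\<close> is the relative entropy of the tilted measure with density proportional to
  \<open>exp (- m * X)\<close>.\<close>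

lemma entropy_mono:
  assumes m: "0 < m" "m \<le> m'"
  shows "- (m\<^sup>2 * \<Psi>' m) \<le> - (m'\<^sup>2 * \<Psi>' m')"
proof (cases "m = m'")
  case False
  \<comment> \<open>These are the derivatives of \<open>ln A\<close>. Convexity gives
    \<open>p \<le> p'\<close>, hence \<open>m * p - ln (A m) \<le> m * p' - ln (A m)\<close>, which
    the tangent at \<open>m'\<close> bounds by the entropy at \<open>m'\<close>.\<close>
  define p p' where "p = A' m / A m" and "p' = A' m' / A m'"
  have m': "m' > 0" using m by simp
  have e: "- (m\<^sup>2 * \<Psi>' m) = m * p - ln (A m)" "- (m'\<^sup>2 * \<Psi>' m') = m' * p' - ln (A m')"
    unfolding \<Psi>'_def p_def p'_def using m m' by (simp_all add: field_simps power2_eq_square)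
  have t1: "ln (A m') + p' * (m - m') \<le> ln (A m)"
    using ln_A_tangent[OF m(1) m'] by (simp add: p'_def)
  have t2: "ln (A m) + p * (m' - m) \<le> ln (A m')"
    using ln_A_tangent[OF m' m(1)] by (simp add: p_def)
  have "(p' - p) * (m - m') \<le> 0" using t1 t2 by (simp add: algebra_simps)
  then have "p \<le> p'" using m False by (simp add: mult_le_0_iff)
  then have "m * p \<le> m * p'" using m by simp
  then show ?thesis unfolding e using t1 by (simp add: algebra_simps)
qed simp

text \<open>Entropy monotonicity gives \<open>\<Psi>' m' \<le> q * \<Psi>' m\<close>, so the
  difference is at most \<open>1 - q \<le> - ln q\<close> times half the variance. The square in
  \<open>q\<close> cancels the half.\<close>

lemma \<Psi>'_diff_le:
  assumes m: "0 < m" "m \<le> m'"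
  shows "\<Psi>' m' - \<Psi>' m \<le> ln (m' / m) * variance X"
proof -
  define q where "q = (m / m')\<^sup>2"
  have q: "0 < q" "q \<le> 1" unfolding q_def using m by (auto simp: power_le_one)
  have "m\<^sup>2 * \<Psi>' m \<ge> m'\<^sup>2 * \<Psi>' m'" using entropy_mono[OF m] by simp
  then have "\<Psi>' m' \<le> q * \<Psi>' m" unfolding q_def using m by (simp add: field_simps)
  then have "\<Psi>' m' - \<Psi>' m \<le> (1 - q) * (- \<Psi>' m)" by (simp add: algebra_simps)
  also have "\<dots> \<le> (1 - q) * (variance X / 2)"
    using q m by (intro mult_left_mono neg_\<Psi>'_le) auto
  also have "\<dots> \<le> (- ln q) * (variance X / 2)"
    using ln_le_minus_one[OF q(1)] by (intro mult_right_mono) auto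
  also have "- ln q = 2 * ln (m' / m)"
    unfolding q_def using m by (simp add: ln_realpow ln_div)
  finally show ?thesis by simp
qed

section \<open>Translation to \<open>Phi\<close>\<close>

lemma Phi_neg: "l < 0 \<Longrightarrow> Phi M X l = \<Psi> (- l)"
  unfolding Phi_def \<Psi>_def A_def by simp

lemma Phi_deriv:
  assumes "l < 0"
  shows "(Phi M X has_real_derivative - \<Psi>' (- l)) (at l)"
proof -
  have "(\<Psi> has_real_derivative \<Psi>' (- l)) (at (- l))" using assms by (intro \<Psi>_deriv) simp
  then have "((\<lambda>l. \<Psi> (- l)) has_real_derivative \<Psi>' (- l) * (- 1)) (at l)"
    by (rule DERIV_chain2) (auto intro!: derivative_eq_intros)
  moreover have "\<forall>\<^sub>F x in nhds l. x < 0" using assms eventually_nhds_in_open[of "{..<0}" l] by auto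
  ultimately show ?thesis
    using assms by (subst DERIV_cong_ev[OF refl _ refl, of _ "\<lambda>l. \<Psi> (- l)"])
      (auto elim!: eventually_mono simp: Phi_neg)
qed

text \<open>Integrability and differentiability are stated explicitly because
  \<open>expectation\<close> and \<open>deriv\<close> are total and would otherwise return default
  values.\<close>

theorem conclusions:
  shows "\<forall>l\<le>0. integrable M (\<lambda>\<omega>. exp (l * X \<omega>))"
    and "\<forall>l\<le>0. ln (expectation (\<lambda>\<omega>. exp (l * (X \<omega> - expectation X)))) \<le> l\<^sup>2 / 2 * variance X"
    and "\<forall>l\<le>0. \<bar>Phi M X l - expectation X\<bar> \<le> \<bar>l\<bar> / 2 * variance X"
    and "\<forall>l<0. Phi M X differentiable at l"
    and "\<forall>l<0. \<forall>l'<0. \<bar>deriv (Phi M X) l - deriv (Phi M X) l'\<bar> \<le> \<bar>ln (l / l')\<bar> * variance X"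
proof -
  show "\<forall>l\<le>0. integrable M (\<lambda>\<omega>. exp (l * X \<omega>))"
  proof (intro allI impI)
    fix l :: real assume "l \<le> 0"
    then show "integrable M (\<lambda>\<omega>. exp (l * X \<omega>))"
      using exp_int[of "- l"] by (cases "l = 0") auto
  qed
  show "\<forall>l\<le>0. ln (expectation (\<lambda>\<omega>. exp (l * (X \<omega> - expectation X)))) \<le> l\<^sup>2 / 2 * variance X"
  proof (intro allI impI)
    fix l :: real assume l: "l \<le> 0"
    show "ln (expectation (\<lambda>\<omega>. exp (l * (X \<omega> - expectation X)))) \<le> l\<^sup>2 / 2 * variance X"
    proof (cases "l = 0")
      case False
      then have l: "l < 0" using l by simp
      have "expectation (\<lambda>\<omega>. exp (l * (X \<omega> - expectation X))) = exp (- l * expectation X) * A (- l)"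
        unfolding A_def integral_mult_right_zero[symmetric] by (simp add: algebra_simps flip: exp_add)
      \<comment> \<open>The centred log-moment is \<open>- l\<close> times the gap between the mean
        and \<open>\<Psi> (- l)\<close>, so the first two claims rest on the same bound
        \<open>\<Psi>_ge\<close>.\<close>
      then have "ln (expectation (\<lambda>\<omega>. exp (l * (X \<omega> - expectation X)))) = - l * (expectation X - \<Psi> (- l))"
        unfolding \<Psi>_def using A_pos[of "- l"] l by (simp add: ln_mult field_simps)
      also have "\<dots> \<le> - l * (- l / 2 * variance X)"
        using l \<Psi>_ge[of "- l"] by (intro mult_left_mono) auto
      finally show ?thesis by (simp add: power2_eq_square)
    qed (simp add: prob_space)
  qed
  show "\<forall>l\<le>0. \<bar>Phi M X l - expectation X\<bar> \<le> \<bar>l\<bar> / 2 * variance X"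
  proof (intro allI impI)
    fix l :: real assume l: "l \<le> 0"
    show "\<bar>Phi M X l - expectation X\<bar> \<le> \<bar>l\<bar> / 2 * variance X"
    proof (cases "l = 0")
      case False
      then show ?thesis using l Phi_neg[of l] \<Psi>_le[of "- l"] \<Psi>_ge[of "- l"] by simp
    qed (simp add: Phi_def)
  qed
  show "\<forall>l<0. Phi M X differentiable at l"
    using Phi_deriv real_differentiable_def by blast
  \<comment> \<open>Ordering the arguments fixes the sign of both differences, as
    \<open>\<Psi>'\<close> is increasing; the other order follows by symmetry.\<close>
  have *: "\<bar>deriv (Phi M X) l - deriv (Phi M X) l'\<bar> \<le> \<bar>ln (l / l')\<bar> * variance X"
    if l: "l \<le> l'" "l' < 0" for l l'
  proof -
    have d: "deriv (Phi M X) l = - \<Psi>' (- l)" "deriv (Phi M X) l' = - \<Psi>' (- l')"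
      using Phi_deriv l by (auto intro!: DERIV_imp_deriv)
    have "\<Psi>' (- l') \<le> \<Psi>' (- l)" "\<Psi>' (- l) - \<Psi>' (- l') \<le> ln (- l / - l') * variance X"
      using l by (intro \<Psi>'_mono \<Psi>'_diff_le; simp)+
    moreover have "ln (l / l') \<ge> 0" using l by (intro ln_ge_zero) (simp add: le_divide_eq)
    ultimately show ?thesis unfolding d by simp
  qed
  show "\<forall>l<0. \<forall>l'<0. \<bar>deriv (Phi M X) l - deriv (Phi M X) l'\<bar> \<le> \<bar>ln (l / l')\<bar> * variance X"
  proof (intro allI impI)
    fix l l' :: real assume l: "l < 0" "l' < 0"
    have "\<bar>ln (l / l')\<bar> = \<bar>ln (l' / l)\<bar>" using l ln_inverse[of "l / l'"] by (simp add: divide_pos_neg ln_divide_pos divide_neg_neg)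
    then show "\<bar>deriv (Phi M X) l - deriv (Phi M X) l'\<bar> \<le> \<bar>ln (l / l')\<bar> * variance X"
      using *[of l l'] *[of l' l] l by (cases "l \<le> l'") (auto simp: abs_minus_commute)
  qed
qed

end

theorem theorem2:
  fixes M :: "'w measure" and g :: "'w \<Rightarrow> real ^ 'n" and F :: "real ^ 'n \<Rightarrow> real"
  assumes "prob_space M"
    and "standard_gaussian_vector M g"
    and "convex_on UNIV F"
    and "integrable M (\<lambda>\<omega>. (F (g \<omega>))\<^sup>2)"
  defines "X \<equiv> \<lambda>\<omega>. F (g \<omega>)"
  shows "(\<forall>l\<le>0. integrable M (\<lambda>\<omega>. exp (l * X \<omega>))) \<and>
         (\<forall>l\<le>0. ln (prob_space.expectation M (\<lambda>\<omega>. exp (l * (X \<omega> - prob_space.expectation M X))))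
                 \<le> l\<^sup>2 / 2 * prob_space.variance M X) \<and>
         (\<forall>l\<le>0. \<bar>Phi M X l - prob_space.expectation M X\<bar>
                 \<le> \<bar>l\<bar> / 2 * prob_space.variance M X) \<and>
         (\<forall>l<0. Phi M X differentiable at l) \<and>
         (\<forall>l<0. \<forall>l'<0. \<bar>deriv (Phi M X) l - deriv (Phi M X) l'\<bar>
                 \<le> \<bar>ln (l / l')\<bar> * prob_space.variance M X)"
proof -
  have "X \<in> borel_measurable M"
    unfolding X_def by (rule gaussian_free_energy_convex(1)[OF assms(1-3)])
  then interpret convex_free_energy M X
    using assms gaussian_free_energy_convex[OF assms(1-3)]
    by (intro convex_free_energy.intro convex_free_energy_axioms.intro) (auto simp: X_def)
  show ?thesis by (intro conjI conclusions)
qed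

end
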